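(* For every integer $k\ge1$, $$H_{\Gamma_{3k+2}\oplus \mathrm{pt}}(q)=k\cdot H_{T_{2k+4}}(q)-(k-1)\,H_{T_{2k+2}\oplus \mathrm{pt}}(q).$$ In particular, for $k=1$ this says $H_{C_5\oplus\mathrm{pt}}(q)=H_{E_6}(q)$, where $C_5=\Gamma_5$ is the $5$-cycle and $E_6=T_6$ is the Dynkin diagram of type $E_6$.
   Context: Notation: $(q)_n=\prod_{j=1}^n(1-q^j)$. Graph series: for a finite simple graph $\Gamma$ with vertices $1,\dots,r$ and adjacency matrix $A_\Gamma$, $$H_\Gamma(q)=\sum_{\mathbf n\in\mathbb Z_{\ge0}^r}\frac{q^{\frac12\mathbf n A_\Gamma\mathbf n^{\mathsf T}+n_1+\cdots+n_r}}{(q)_{n_1}\cdots(q)_{n_r}},$$ a formal power series in $q$. The symbol $\oplus$ denotes disjoint union of graphs, and $\mathrm{pt}$ is the graph with one vertex and no edges. The graph $\Gamma_{3k+2}$ ($k\ge1$) has vertices $1,2,\dots,3k+2$ and exactly the following edges: $1\sim2\sim3\sim4\sim5\sim1$; $i\sim i+1$ for $5\le i\le 3k+1$; $1\sim 3t+2$ and $4\sim 3t+2$ for $2\le t\le k$; and $3s+1\sim 3(\ell+1)+2$ for $2\le s\le \ell\le k-1$. The graph $T_{2k+2}$ ($k\ge 1$) is the star-shaped tree with vertices $1,\dots,2k+2$ and edges $1\sim 2j$ and $2j\sim 2j+1$ for $1\le j\le k$, and $1\sim 2k+2$. *)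

theory Defs
  imports
    "HOL-Analysis.Infinite_Sum"
    "HOL-Computational_Algebra.Formal_Power_Series"
    "Graph_Theory.Graph_Theory"
begin

unbundle fps_syntax

text \<open>
  A finite simple graph is a \<^locale>\<open>pair_graph\<close>: a finite digraph with symmetric,
  irreflexive arc relation.  Every undirected edge is thus represented by two arcs.
\<close>

definition edge_graph :: "'a set \<Rightarrow> ('a \<times> 'a) set \<Rightarrow> 'a pair_pre_digraph" where
  "edge_graph V E = \<lparr>pverts = V, parcs = E \<union> E\<inverse>\<rparr>"

definition disjoint_union ::
  "'a pair_pre_digraph \<Rightarrow> 'b pair_pre_digraph \<Rightarrow> ('a + 'b) pair_pre_digraph"
  (infixl \<open>\<oplus>\<close> 65) where
  "G \<oplus> H = \<lparr>pverts = pverts G <+> pverts H,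
            parcs = map_prod Inl Inl ` parcs G \<union> map_prod Inr Inr ` parcs H\<rparr>"

definition pt :: "unit pair_pre_digraph" where
  "pt = \<lparr>pverts = {()}, parcs = {}\<rparr>"

definition adj_matrix :: "'a pair_pre_digraph \<Rightarrow> 'a \<Rightarrow> 'a \<Rightarrow> nat" where
  "adj_matrix G i j = of_bool ((i, j) \<in> parcs G)"

definition qpoch :: "nat \<Rightarrow> rat fps" where
  "qpoch n = (\<Prod>j=1..n. 1 - fps_X ^ j)"

definition adj_form :: "'a pair_pre_digraph \<Rightarrow> ('a \<Rightarrow> nat) \<Rightarrow> nat" where
  "adj_form G n = (\<Sum>i\<in>pverts G. \<Sum>j\<in>pverts G. n i * adj_matrix G i j * n j)"

text \<open>
  The truncating division by 2 is exact: see \<open>even_adj_form\<close> below.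
\<close>

definition graph_exponent :: "'a pair_pre_digraph \<Rightarrow> ('a \<Rightarrow> nat) \<Rightarrow> nat" where
  "graph_exponent G n = adj_form G n div 2 + (\<Sum>i\<in>pverts G. n i)"

definition graph_term :: "'a pair_pre_digraph \<Rightarrow> ('a \<Rightarrow> nat) \<Rightarrow> rat fps" where
  "graph_term G n = fps_X ^ graph_exponent G n / (\<Prod>i\<in>pverts G. qpoch (n i))"

text \<open>
  The infinite sum is taken in the metric (that is, \<open>q\<close>-adic) topology of \<^typ>\<open>rat fps\<close>;
  it converges by \<open>graph_term_summable\<close> below.
\<close>

definition graph_series :: "'a pair_pre_digraph \<Rightarrow> rat fps" where
  "graph_series G = infsum (graph_term G) (pverts G \<rightarrow>\<^sub>E UNIV)"

text \<open>
  \<open>Gamma_graph k\<close> is the graph $\Gamma_{3k+2}$ and \<open>T_graph k\<close> is the tree $T_{2k+2}$: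
  the argument is \<open>k\<close>, not the number of vertices.
\<close>

definition Gamma_graph :: "nat \<Rightarrow> nat pair_pre_digraph" where
  "Gamma_graph k = edge_graph {1..3 * k + 2}
     ({(1, 2), (2, 3), (3, 4), (4, 5), (5, 1)}
      \<union> {(i, i + 1) |i. 5 \<le> i \<and> i \<le> 3 * k + 1}
      \<union> {(1, 3 * t + 2) |t. 2 \<le> t \<and> t \<le> k}
      \<union> {(4, 3 * t + 2) |t. 2 \<le> t \<and> t \<le> k}
      \<union> {(3 * s + 1, 3 * (l + 1) + 2) |s l. 2 \<le> s \<and> s \<le> l \<and> l \<le> k - 1})"

definition T_graph :: "nat \<Rightarrow> nat pair_pre_digraph" where
  "T_graph k = edge_graph {1..2 * k + 2}
     ({(1, 2 * j) |j. 1 \<le> j \<and> j \<le> k}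
      \<union> {(2 * j, 2 * j + 1) |j. 1 \<le> j \<and> j \<le> k}
      \<union> {(1, 2 * k + 2)})"

definition cycle_graph :: "nat \<Rightarrow> nat pair_pre_digraph" where
  "cycle_graph n = edge_graph {1..n} ({(i, i + 1) |i. 1 \<le> i \<and> i < n} \<union> {(n, 1)})"

text \<open>The Dynkin diagram of type $E_6$ in the labelling of Bourbaki.\<close>

definition E6_graph :: "nat pair_pre_digraph" where
  "E6_graph = edge_graph {1..6} {(1, 3), (3, 4), (4, 5), (5, 6), (2, 4)}"

lemma pair_graph_edge_graph:
  assumes "finite V" "E \<subseteq> V \<times> V" "\<And>x. (x, x) \<notin> E"
  shows "pair_graph (edge_graph V E)"
proof -
  have fin: "finite E"
    using assms(1,2) by (meson finite_SigmaI finite_subset)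
  have sym: "sym (E \<union> E\<inverse>)"
    by (auto intro: symI)
  show ?thesis
    using assms fin sym
    by unfold_locales (auto simp: edge_graph_def symmetric_def)
qed

lemma pair_graph_Gamma: "k \<ge> 1 \<Longrightarrow> pair_graph (Gamma_graph k)"
  unfolding Gamma_graph_def by (rule pair_graph_edge_graph) auto

lemma pair_graph_T: "pair_graph (T_graph k)"
  unfolding T_graph_def by (rule pair_graph_edge_graph) auto

lemma pair_graph_cycle: "n \<ge> 2 \<Longrightarrow> pair_graph (cycle_graph n)"
  unfolding cycle_graph_def by (rule pair_graph_edge_graph) auto

lemma pair_graph_E6: "pair_graph E6_graph"
  unfolding E6_graph_def by (rule pair_graph_edge_graph) auto

lemma pair_graph_pt: "pair_graph pt"
  by unfold_locales (auto simp: pt_def symmetric_def sym_def)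

lemma pair_graph_disjoint_union:
  assumes "pair_graph G" "pair_graph H"
  shows "pair_graph (G \<oplus> H)"
proof -
  interpret G: pair_graph G by fact
  interpret H: pair_graph H by fact
  have "sym (parcs G)" "sym (parcs H)"
    using G.pair_sym_arcs H.pair_sym_arcs by (auto simp: symmetric_def)
  hence sym: "sym (parcs (G \<oplus> H))"
    by (auto simp: disjoint_union_def sym_def map_prod_def image_iff split: prod.splits) blast+
  show ?thesis
    using G.pair_finite_verts H.pair_finite_verts G.pair_finite_arcs H.pair_finite_arcs sym
    by unfold_locales
       (auto simp: disjoint_union_def symmetric_def dest: G.pair_no_loops H.pair_no_loops
          G.in_arcsD1 H.in_arcsD1 G.in_arcsD2 H.in_arcsD2)
qed

lemma even_adj_form:
  assumes "pair_graph G"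
  shows "even (adj_form G n)"
proof -
  interpret pair_graph G by fact
  have sym: "(i, j) \<in> parcs G \<longleftrightarrow> (j, i) \<in> parcs G" for i j
    using pair_sym_arcs by (auto simp: symmetric_def sym_def)
  have irr: "(i, i) \<notin> parcs G" for i
    using pair_no_loops by force
  have "even (\<Sum>i\<in>V. \<Sum>j\<in>V. n i * adj_matrix G i j * n j)" if "finite V" for V
    using that
  proof (induction V)
    case empty
    then show ?case by simp
  next
    case (insert x V)
    have "(\<Sum>i\<in>V. n i * adj_matrix G i x * n x) = (\<Sum>j\<in>V. n x * adj_matrix G x j * n j)"
      by (intro sum.cong) (auto simp: adj_matrix_def sym)
    with insert show ?case
      by (simp add: sum.distrib irr adj_matrix_def)
  qed
  thus ?thesis
    unfolding adj_form_def using pair_finite_verts by blast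
qed

lemma fps_nth_0_prod:
  fixes f :: "'a \<Rightarrow> 'b::comm_ring_1 fps"
  shows "(\<Prod>i\<in>I. f i) $ 0 = (\<Prod>i\<in>I. f i $ 0)"
  by (induction I rule: infinite_finite_induct) simp_all

lemma graph_term_nth_eq_0:
  assumes "m < graph_exponent G n"
  shows "graph_term G n $ m = 0"
proof -
  have "qpoch l $ 0 = 1" for l
    by (simp add: qpoch_def fps_nth_0_prod power_0_left)
  hence "(\<Prod>i\<in>pverts G. qpoch (n i)) $ 0 = 1"
    by (simp add: fps_nth_0_prod)
  hence "graph_term G n = fps_X ^ graph_exponent G n * inverse (\<Prod>i\<in>pverts G. qpoch (n i))"
    unfolding graph_term_def by (intro fps_divide_unit) auto
  thus ?thesis
    using assms by (simp add: fps_X_power_mult_nth)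
qed

lemma finite_graph_exponent_le:
  assumes "finite (pverts G)"
  shows "finite {n \<in> pverts G \<rightarrow>\<^sub>E UNIV. graph_exponent G n \<le> m}"
proof (rule finite_subset)
  show "finite (pverts G \<rightarrow>\<^sub>E {..m})"
    using assms by (intro finite_PiE) auto
  have "n i \<le> m" if "graph_exponent G n \<le> m" "i \<in> pverts G" for n i
    using that member_le_sum[of i "pverts G" n] assms by (simp add: graph_exponent_def)
  thus "{n \<in> pverts G \<rightarrow>\<^sub>E UNIV. graph_exponent G n \<le> m} \<subseteq> (pverts G \<rightarrow>\<^sub>E {..m})"
    by (auto simp: PiE_iff extensional_def)
qed

lemma graph_term_has_sum:
  assumes "finite (pverts G)"
  shows "(graph_term G has_sum Abs_fps (\<lambda>m.
            \<Sum>n | n \<in> (pverts G \<rightarrow>\<^sub>E UNIV) \<and> graph_exponent G n \<le> m. graph_term G n $ m))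
         (pverts G \<rightarrow>\<^sub>E UNIV)"
proof -
  define A where "A = pverts G \<rightarrow>\<^sub>E (UNIV :: nat set)"
  define B where "B m = {n \<in> A. graph_exponent G n \<le> m}" for m
  define S where "S = Abs_fps (\<lambda>m. \<Sum>n\<in>B m. graph_term G n $ m)"
  have fin: "finite (B m)" for m
    unfolding B_def A_def by (rule finite_graph_exponent_le[OF assms])
  have "(sum (graph_term G) \<longlongrightarrow> S) (finite_subsets_at_top A)"
  proof (rule tendsto_fpsI)
    fix m
    have "eventually (\<lambda>F. finite F \<and> B m \<subseteq> F \<and> F \<subseteq> A) (finite_subsets_at_top A)"
      unfolding eventually_finite_subsets_at_top
      using fin[of m] by (intro exI[of _ "B m"]) (auto simp: B_def)
    thus "eventually (\<lambda>F. sum (graph_term G) F $ m = S $ m) (finite_subsets_at_top A)"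
    proof eventually_elim
      case (elim F)
      hence "(\<Sum>n\<in>F. graph_term G n $ m) = (\<Sum>n\<in>B m. graph_term G n $ m)"
        by (intro sum.mono_neutral_right) (force simp: B_def intro!: graph_term_nth_eq_0)+
      thus ?case by (simp add: S_def fps_sum_nth)
    qed
  qed
  thus ?thesis
    by (simp add: has_sum_def S_def B_def A_def)
qed

lemma graph_term_summable:
  "finite (pverts G) \<Longrightarrow> graph_term G summable_on (pverts G \<rightarrow>\<^sub>E UNIV)"
  using graph_term_has_sum by (auto simp: summable_on_def)

end

theory Submission
  imports Defs
begin

text \<open>
  Write $E = \sum_n q^n/(q)_n$. Euler's identity $\sum_n q^{n(N+1)}/(q)_n = (q)_N E$ allows one
  to sum out any independent set of vertices.  Applied to the leaves of $T_{2k+2}$ it gives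
  $H_{T_{2k+2}} = E^{k+1} \sum_n q^n/(1-q^{n+1})^k$.  In $\Gamma_{3k+2}$ let $b_s$, $c_s$, $d_s$ be
  the summation variables at the vertices $3s+1$, $3s+2$, $3s+3$: then $b_s$ is joined to $c_t$ for
  $s \le t$, and $d_s$ to $c_s$ and $b_{s+1}$.  Summing out $b_0$ and all $d_s$, and then the other
  $b_s$, one is left with $E^{k+1}$ times the sum of
  $q^{S_0} \prod_{s<k} (1-q^{S_s+1})^{-1}$ over all chains $S_0 \ge \dots \ge S_k \ge 0$, where
  $S_s = c_s + \dots + c_k$.  The chain sum is computed by expanding its partial sums in a family
  $t_r(j)$ whose coefficients turn out to be the binomial coefficients
  $\beta_k(r) = \binom{r+k-1}{r}$, so that it equals
  $\sum_r \beta_k(r)\,(r+1)\,q^r/(1-q^{r+1})$, whereas the sum for the tree is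
  $\sum_r \beta_k(r)\,q^r/(1-q^{r+1})$.  The claim thus reduces to
  $(r+1)\,\beta_k(r) = k\,\beta_{k+1}(r) - (k-1)\,\beta_k(r)$.
\<close>

section \<open>Formal sums of families of power series\<close>

text \<open>The functions t_r come from inverting an operator. Put (D f)(j) = (1 - q^(j+1)) (f(j) -
  f(j+1)). Summing over one more link of a chain inverts D, so the chain sum with k links is D^(-k)
  applied to q^j. The negative binomial expansion of D^(-k) = (1 - (1 - D))^(-k) then yields the
  coefficients binom(r+k-1, r) together with t_r = (1 - D)^r q^j. For the tree the same coefficients
  come from expanding (1 - q^(n+1))^(-k). The factor r+1 that separates the two results is the total
  of t_r over all j, divided by q^r/(1 - q^(r+1)). The order of summation changes many times. All
  sums are therefore taken coefficient by coefficient, with finitely many contributions to each, so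
  that every exchange is one of finite sums; the q-adic limit in the definition of a graph series is
  traded for such a sum once, in \<open>graph_series_eq\<close>.\<close>

definition fps_summable :: "('i \<Rightarrow> 'a::comm_ring_1 fps) \<Rightarrow> 'i set \<Rightarrow> bool" where
  "fps_summable f A \<longleftrightarrow> (\<forall>m. finite {i \<in> A. f i $ m \<noteq> 0})"

text \<open>For a family that is not summable, the sums over infinite sets below have the junk value 0.\<close>

definition fps_sum :: "('i \<Rightarrow> 'a::comm_ring_1 fps) \<Rightarrow> 'i set \<Rightarrow> 'a fps" where
  "fps_sum f A = Abs_fps (\<lambda>m. \<Sum>i | i \<in> A \<and> f i $ m \<noteq> 0. f i $ m)"

text \<open>The support in the definition of \<open>fps_sum\<close> depends on the family and on m.
  Replacing it by any finite set that contains it lets several families be compared over one common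
  index set.\<close>

lemma fps_sum_nth_eq:
  assumes "finite F" "F \<subseteq> A" "\<And>i. i \<in> A - F \<Longrightarrow> f i $ m = 0"
  shows "fps_sum f A $ m = (\<Sum>i\<in>F. f i $ m)"
  unfolding fps_sum_def fps_nth_Abs_fps
  using assms by (intro sum.mono_neutral_left) auto

lemma fps_summableD:
  assumes "fps_summable f A"
  obtains F where "finite F" "F \<subseteq> A" "\<And>i. i \<in> A - F \<Longrightarrow> f i $ m = 0"
  using assms by (intro that[of "{i \<in> A. f i $ m \<noteq> 0}"]) (auto simp: fps_summable_def)

text \<open>A coefficient of a product involves all lower coefficients of its factors, so one finite
  set has to serve every degree up to m. The union of the supports does.\<close>

lemma fps_summableD_le:
  assumes "fps_summable f A"
  obtains F where "finite F" "F \<subseteq> A" "\<And>i l. i \<in> A - F \<Longrightarrow> l \<le> m \<Longrightarrow> f i $ l = 0"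
  using assms by (intro that[of "\<Union>l\<le>m. {i \<in> A. f i $ l \<noteq> 0}"]) (auto simp: fps_summable_def)

lemma fps_summable_finite: "finite A \<Longrightarrow> fps_summable f A"
  by (simp add: fps_summable_def)

lemma fps_sum_finite: "finite A \<Longrightarrow> fps_sum f A = (\<Sum>i\<in>A. f i)"
  by (rule fps_ext) (subst fps_sum_nth_eq[of A], auto simp: fps_sum_nth)

lemma fps_sum_cong:
  "(\<And>i. i \<in> A \<Longrightarrow> f i = g i) \<Longrightarrow> fps_sum f A = fps_sum g A"
  by (rule fps_ext) (auto simp: fps_sum_def intro!: sum.cong)

lemma fps_summable_cong:
  "(\<And>i. i \<in> A \<Longrightarrow> f i = g i) \<Longrightarrow> fps_summable f A \<longleftrightarrow> fps_summable g A"
  by (simp add: fps_summable_def cong: conj_cong)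

lemma fps_summable_X_power:
  assumes "\<And>m. finite {i \<in> A. e i \<le> m}"
  shows "fps_summable (\<lambda>i. fps_X ^ e i * g i) A"
  unfolding fps_summable_def
proof
  fix m
  have "{i \<in> A. (fps_X ^ e i * g i) $ m \<noteq> 0} \<subseteq> {i \<in> A. e i \<le> m}"
    by (auto simp: fps_X_power_mult_nth split: if_splits)
  thus "finite {i \<in> A. (fps_X ^ e i * g i) $ m \<noteq> 0}"
    using assms finite_subset by blast
qed

lemma fps_summable_nat_X_power:
  assumes "\<And>i. i \<le> e i"
  shows "fps_summable (\<lambda>i::nat. fps_X ^ e i * g i) A"
proof (rule fps_summable_X_power)
  fix m
  have "{i \<in> A. e i \<le> m} \<subseteq> {..m}"
    using assms by (auto intro: order_trans)
  thus "finite {i \<in> A. e i \<le> m}"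
    using finite_subset by blast
qed

lemma fps_summable_mult_left:
  assumes "fps_summable f A"
  shows "fps_summable (\<lambda>i. c * f i) A"
  unfolding fps_summable_def
proof
  fix m
  obtain F where F: "finite F" "F \<subseteq> A" "\<And>i l. i \<in> A - F \<Longrightarrow> l \<le> m \<Longrightarrow> f i $ l = 0"
    using fps_summableD_le[OF assms] by blast
  have "{i \<in> A. (c * f i) $ m \<noteq> 0} \<subseteq> F"
  proof safe
    fix i assume "i \<in> A" "(c * f i) $ m \<noteq> 0"
    moreover have "(c * f i) $ m = 0" if "i \<in> A - F"
      using F(3)[OF that] by (simp add: fps_mult_nth)
    ultimately show "i \<in> F" by blast
  qed
  thus "finite {i \<in> A. (c * f i) $ m \<noteq> 0}"
    using F(1) finite_subset by blast
qed

lemma fps_summable_add: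
  assumes "fps_summable f A" "fps_summable g A"
  shows "fps_summable (\<lambda>i. f i + g i) A"
  unfolding fps_summable_def
proof
  fix m
  have "{i \<in> A. (f i + g i) $ m \<noteq> 0} \<subseteq> {i \<in> A. f i $ m \<noteq> 0} \<union> {i \<in> A. g i $ m \<noteq> 0}"
    by auto
  thus "finite {i \<in> A. (f i + g i) $ m \<noteq> 0}"
    by (rule finite_subset) (use assms in \<open>simp add: fps_summable_def\<close>)
qed

lemma fps_sum_mult_left:
  assumes "fps_summable f A"
  shows "fps_sum (\<lambda>i. c * f i) A = c * fps_sum f A"
proof (rule fps_ext)
  fix m
  obtain F where F: "finite F" "F \<subseteq> A" "\<And>i l. i \<in> A - F \<Longrightarrow> l \<le> m \<Longrightarrow> f i $ l = 0"
    using fps_summableD_le[OF assms] by blast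
  have "fps_sum (\<lambda>i. c * f i) A $ m = (\<Sum>i\<in>F. (c * f i) $ m)"
  proof (rule fps_sum_nth_eq[OF F(1,2)])
    fix i assume "i \<in> A - F"
    thus "(c * f i) $ m = 0"
      using F(3) by (simp add: fps_mult_nth)
  qed
  also have "\<dots> = (\<Sum>l=0..m. c $ l * (\<Sum>i\<in>F. f i $ (m - l)))"
    by (subst sum_distrib_left, subst sum.swap) (simp add: fps_mult_nth)
  also have "\<dots> = (\<Sum>l=0..m. c $ l * fps_sum f A $ (m - l))"
    by (intro sum.cong refl arg_cong2[of _ _ _ _ "(*)"] fps_sum_nth_eq[symmetric] F) auto
  finally show "fps_sum (\<lambda>i. c * f i) A $ m = (c * fps_sum f A) $ m"
    by (simp add: fps_mult_nth)
qed

lemma fps_sum_mult_right: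
  assumes "fps_summable f A"
  shows "fps_sum (\<lambda>i. f i * c) A = fps_sum f A * c"
  using fps_sum_mult_left[OF assms, of c] by (simp add: mult.commute)

lemma fps_sum_add:
  fixes f g :: "'i \<Rightarrow> 'a::comm_ring_1 fps"
  assumes "fps_summable f A" "fps_summable g A"
  shows "fps_sum (\<lambda>i. f i + g i) A = fps_sum f A + fps_sum g A"
proof (rule fps_ext)
  fix m
  obtain F where F: "finite F" "F \<subseteq> A" "\<And>i. i \<in> A - F \<Longrightarrow> f i $ m = 0"
    using fps_summableD[OF assms(1)] by blast
  obtain G where G: "finite G" "G \<subseteq> A" "\<And>i. i \<in> A - G \<Longrightarrow> g i $ m = 0"
    using fps_summableD[OF assms(2)] by blast
  have "fps_sum h A $ m = (\<Sum>i\<in>F \<union> G. h i $ m)"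
    if "\<And>i. i \<in> A - (F \<union> G) \<Longrightarrow> h i $ m = 0" for h :: "'i \<Rightarrow> 'a fps"
    using F G that by (intro fps_sum_nth_eq) auto
  thus "fps_sum (\<lambda>i. f i + g i) A $ m = (fps_sum f A + fps_sum g A) $ m"
    using F G by (simp add: sum.distrib)
qed

lemma fps_sum_diff:
  fixes f g :: "'i \<Rightarrow> 'a::comm_ring_1 fps"
  assumes "fps_summable f A" "fps_summable g A"
  shows "fps_sum (\<lambda>i. f i - g i) A = fps_sum f A - fps_sum g A"
  using fps_sum_add[OF assms(1) fps_summable_mult_left[OF assms(2), of "-1"]]
  by (simp add: fps_sum_mult_left[OF assms(2), of "-1", simplified])

lemma fps_summable_reindex:
  assumes "bij_betw h A B"
  shows "fps_summable (\<lambda>x. f (h x)) A \<longleftrightarrow> fps_summable f B"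
proof -
  have "finite {x \<in> A. f (h x) $ m \<noteq> 0} \<longleftrightarrow> finite {y \<in> B. f y $ m \<noteq> 0}" for m
  proof (rule bij_betw_finite)
    show "bij_betw h {x \<in> A. f (h x) $ m \<noteq> 0} {y \<in> B. f y $ m \<noteq> 0}"
      using assms by (auto simp: bij_betw_def inj_on_def)
  qed
  thus ?thesis by (simp add: fps_summable_def)
qed

lemma fps_sum_reindex:
  assumes "bij_betw h A B"
  shows "fps_sum (\<lambda>x. f (h x)) A = fps_sum f B"
proof (rule fps_ext)
  fix m
  have "bij_betw h {x \<in> A. f (h x) $ m \<noteq> 0} {y \<in> B. f y $ m \<noteq> 0}"
    using assms by (auto simp: bij_betw_def inj_on_def)
  from sum.reindex_bij_betw[OF this, of "\<lambda>y. f y $ m"]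
  show "fps_sum (\<lambda>x. f (h x)) A $ m = fps_sum f B $ m"
    by (simp add: fps_sum_def)
qed

text \<open>The two projections of the finite support span a finite rectangle. For each coefficient,
  Fubini is then the exchange of two finite sums over F and G.\<close>

lemma fps_summable_Times_nth:
  assumes "fps_summable (\<lambda>(x, y). f x y) (A \<times> B)"
  shows "\<exists>F G. finite F \<and> F \<subseteq> A \<and> finite G \<and> G \<subseteq> B \<and>
           (\<forall>x\<in>A. \<forall>y\<in>B. f x y $ m \<noteq> 0 \<longrightarrow> x \<in> F \<and> y \<in> G)"
proof -
  obtain N where N: "finite N" "N \<subseteq> A \<times> B"
    "\<And>p. p \<in> A \<times> B - N \<Longrightarrow> (case p of (x, y) \<Rightarrow> f x y) $ m = 0"
    using fps_summableD[OF assms] by blast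
  have "x \<in> fst ` N \<and> y \<in> snd ` N" if "x \<in> A" "y \<in> B" "f x y $ m \<noteq> 0" for x y
  proof -
    have "(x, y) \<in> N"
      using N(3)[of "(x, y)"] that by auto
    thus ?thesis by (metis fst_conv snd_conv imageI)
  qed
  moreover have "fst ` N \<subseteq> A" "snd ` N \<subseteq> B"
    using N(2) by auto
  ultimately show ?thesis
    using N(1) by (intro exI[of _ "fst ` N"] exI[of _ "snd ` N"]) simp
qed

lemma fps_sum_Times:
  assumes "fps_summable (\<lambda>(x, y). f x y) (A \<times> B)"
  shows "fps_sum (\<lambda>(x, y). f x y) (A \<times> B) = fps_sum (\<lambda>x. fps_sum (f x) B) A"
proof (rule fps_ext)
  fix m
  obtain F G where FG: "finite F" "F \<subseteq> A" "finite G" "G \<subseteq> B"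
    "\<And>x y. x \<in> A \<Longrightarrow> y \<in> B \<Longrightarrow> f x y $ m \<noteq> 0 \<Longrightarrow> x \<in> F \<and> y \<in> G"
    using fps_summable_Times_nth[OF assms, of m] by auto
  have inner: "fps_sum (f x) B $ m = (\<Sum>y\<in>G. f x y $ m)" if "x \<in> A" for x
    using FG that by (intro fps_sum_nth_eq) auto
  have outer: "fps_sum (f x) B $ m = 0" if "x \<in> A - F" for x
    using inner[of x] that FG(4,5) by (auto intro!: sum.neutral)
  have "fps_sum (\<lambda>(x, y). f x y) (A \<times> B) $ m = (\<Sum>p\<in>F \<times> G. (case p of (x, y) \<Rightarrow> f x y) $ m)"
    using FG by (intro fps_sum_nth_eq) auto
  also have "\<dots> = (\<Sum>x\<in>F. \<Sum>y\<in>G. f x y $ m)"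
    by (simp add: sum.cartesian_product case_prod_unfold)
  also have "\<dots> = (\<Sum>x\<in>F. fps_sum (f x) B $ m)"
    using inner FG(2) by (intro sum.cong) auto
  also have "\<dots> = fps_sum (\<lambda>x. fps_sum (f x) B) A $ m"
    using outer FG by (intro fps_sum_nth_eq[symmetric]) auto
  finally show "fps_sum (\<lambda>(x, y). f x y) (A \<times> B) $ m = fps_sum (\<lambda>x. fps_sum (f x) B) A $ m" .
qed

lemma fps_sum_swap:
  assumes "fps_summable (\<lambda>(x, y). f x y) (A \<times> B)"
  shows "fps_sum (\<lambda>x. fps_sum (f x) B) A = fps_sum (\<lambda>y. fps_sum (\<lambda>x. f x y) A) B"
proof -
  have bij: "bij_betw prod.swap (B \<times> A) (A \<times> B)"
    by (auto simp: bij_betw_def)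
  have "fps_summable (\<lambda>(y, x). f x y) (B \<times> A)"
    using fps_summable_reindex[OF bij, of "\<lambda>(x, y). f x y"] assms
    by (simp add: case_prod_unfold)
  from fps_sum_Times[OF this] fps_sum_Times[OF assms]
    fps_sum_reindex[OF bij, of "\<lambda>(x, y). f x y"]
  show ?thesis by (simp add: case_prod_unfold)
qed

lemma fps_summable_times:
  assumes "fps_summable f A" "fps_summable g B"
  shows "fps_summable (\<lambda>(x, y). f x * g y) (A \<times> B)"
  unfolding fps_summable_def
proof
  fix m
  obtain F where F: "finite F" "F \<subseteq> A" "\<And>i l. i \<in> A - F \<Longrightarrow> l \<le> m \<Longrightarrow> f i $ l = 0"
    using fps_summableD_le[OF assms(1)] by blast
  obtain G where G: "finite G" "G \<subseteq> B" "\<And>i l. i \<in> B - G \<Longrightarrow> l \<le> m \<Longrightarrow> g i $ l = 0"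
    using fps_summableD_le[OF assms(2)] by blast
  have "(f x * g y) $ m = 0" if "x \<in> A" "y \<in> B" "(x, y) \<notin> F \<times> G" for x y
    unfolding fps_mult_nth using that F(3)[of x] G(3)[of y]
    by (intro sum.neutral) auto
  hence "{p \<in> A \<times> B. (case p of (x, y) \<Rightarrow> f x * g y) $ m \<noteq> 0} \<subseteq> F \<times> G"
    by auto
  thus "finite {p \<in> A \<times> B. (case p of (x, y) \<Rightarrow> f x * g y) $ m \<noteq> 0}"
    using F(1) G(1) by (meson finite_SigmaI finite_subset)
qed

lemma fps_sum_times:
  assumes "fps_summable f A" "fps_summable g B"
  shows "fps_sum (\<lambda>(x, y). f x * g y) (A \<times> B) = fps_sum f A * fps_sum g B"
  by (subst fps_sum_Times[OF fps_summable_times[OF assms]])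
     (simp add: fps_sum_mult_left assms fps_sum_mult_right)

section \<open>Sums over finitely many independent variables\<close>

lemma bij_betw_PiE_Un:
  assumes "I \<inter> J = {}"
  shows "bij_betw (\<lambda>(x, y) i. if i \<in> I then x i else y i)
           (PiE I A \<times> PiE J A) (PiE (I \<union> J) A)"
proof (rule bij_betwI[where g = "\<lambda>x. (restrict x I, restrict x J)"])
  show "(\<lambda>(x, y) i. if i \<in> I then x i else y i) \<in> PiE I A \<times> PiE J A \<rightarrow> PiE (I \<union> J) A"
    by (auto simp: PiE_iff extensional_def)
qed (use assms in \<open>auto simp: PiE_iff extensional_def fun_eq_iff restrict_def\<close>)

lemma fps_sum_PiE_Un:
  assumes "I \<inter> J = {}" "fps_summable f (PiE (I \<union> J) A)"
  shows "fps_sum f (PiE (I \<union> J) A) =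
           fps_sum (\<lambda>x. fps_sum (\<lambda>y. f (\<lambda>i. if i \<in> I then x i else y i)) (PiE J A)) (PiE I A)"
proof -
  note bij = bij_betw_PiE_Un[OF assms(1), of A]
  have "fps_summable (\<lambda>(x, y). f (\<lambda>i. if i \<in> I then x i else y i)) (PiE I A \<times> PiE J A)"
    using fps_summable_reindex[OF bij, of f] assms(2) by (simp add: case_prod_unfold)
  from fps_sum_Times[OF this] show ?thesis
    using fps_sum_reindex[OF bij, of f] by (simp add: case_prod_unfold)
qed

lemma bij_betw_PiE_singleton: "bij_betw (\<lambda>x. \<lambda>j\<in>{i}. x) (A i) (PiE {i} A)"
  by (rule bij_betwI[where g = "\<lambda>x. x i"]) (auto simp: PiE_iff extensional_def fun_eq_iff)

text \<open>The elements of \<open>PiE {i} A\<close> have the value \<open>undefined\<close> away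
  from i; a function that reads only coordinate i does not distinguish them from constant
  functions.\<close>

lemma fps_sum_PiE_singleton:
  assumes "\<And>x y. x i = y i \<Longrightarrow> f x = f y"
  shows "fps_sum f (PiE {i} A) = fps_sum (\<lambda>x. f (\<lambda>_. x)) (A i)"
proof -
  have "fps_sum (\<lambda>x. f (\<lambda>j\<in>{i}. x)) (A i) = fps_sum f (PiE {i} A)"
    by (rule fps_sum_reindex[OF bij_betw_PiE_singleton])
  moreover have "f (\<lambda>j\<in>{i}. x) = f (\<lambda>_. x)" for x
    by (rule assms) simp
  ultimately show ?thesis by simp
qed

text \<open>Distributive law for finitely many infinite sums. Both claims go into one induction
  because evaluating the product in the step requires summability of the product over I.\<close>

lemma fps_sum_prod_PiE_aux:
  assumes "finite I" "\<And>i. i \<in> I \<Longrightarrow> fps_summable (h i) (A i)"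
  shows "fps_summable (\<lambda>x. \<Prod>i\<in>I. h i (x i)) (PiE I A) \<and>
         fps_sum (\<lambda>x. \<Prod>i\<in>I. h i (x i)) (PiE I A) = (\<Prod>i\<in>I. fps_sum (h i) (A i))"
  using assms
proof (induction I)
  case empty
  then show ?case by (simp add: fps_summable_finite fps_sum_finite)
next
  case (insert i I)
  have bij: "bij_betw (\<lambda>(a, x). x(i := a)) (A i \<times> PiE I A) (PiE (insert i I) A)"
    unfolding bij_betw_def using inj_combinator[OF insert.hyps(2)]
    by (simp add: PiE_insert_eq case_prod_unfold)
  have eq: "(\<Prod>j\<in>insert i I. h j ((x(i := a)) j)) = h i a * (\<Prod>j\<in>I. h j (x j))" for a x
  proof -
    have "(\<Prod>j\<in>I. h j ((x(i := a)) j)) = (\<Prod>j\<in>I. h j (x j))"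
      using insert.hyps(2) by (intro prod.cong) auto
    thus ?thesis using insert.hyps by simp
  qed
  from insert have IH: "fps_summable (\<lambda>x. \<Prod>i\<in>I. h i (x i)) (PiE I A)"
    "fps_sum (\<lambda>x. \<Prod>i\<in>I. h i (x i)) (PiE I A) = (\<Prod>i\<in>I. fps_sum (h i) (A i))"
    "fps_summable (h i) (A i)"
    by auto
  define f where "f = (\<lambda>x. \<Prod>j\<in>insert i I. h j (x j))"
  have f: "(\<lambda>p. f (case p of (a, x) \<Rightarrow> x(i := a))) = (\<lambda>(a, x). h i a * (\<Prod>j\<in>I. h j (x j)))"
    unfolding f_def using eq by (simp add: fun_eq_iff del: prod.insert fun_upd_apply)
  have "fps_summable f (PiE (insert i I) A)"
    using fps_summable_reindex[OF bij, of f] fps_summable_times[OF IH(3,1)] by (simp add: f)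
  moreover have "fps_sum f (PiE (insert i I) A) = fps_sum (h i) (A i) * (\<Prod>j\<in>I. fps_sum (h j) (A j))"
    using fps_sum_reindex[OF bij, of f] fps_sum_times[OF IH(3,1)] by (simp add: f IH(2))
  ultimately show ?case
    using insert.hyps by (simp add: f_def)
qed

lemmas fps_summable_prod_PiE = fps_sum_prod_PiE_aux[THEN conjunct1]
  and fps_sum_prod_PiE = fps_sum_prod_PiE_aux[THEN conjunct2]

text \<open>For i in I, c i is at most the sum and hence at most e c, so bounding the exponent by m
  confines c to a finite box.\<close>

lemma fps_summable_PiE_X_power:
  assumes "finite I" "\<And>c. (\<Sum>i\<in>I. c i) \<le> e c"
  shows "fps_summable (\<lambda>c. fps_X ^ e c * g c) (PiE I (\<lambda>_. UNIV :: nat set))"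
proof (rule fps_summable_X_power)
  fix m
  have "c i \<le> m" if "e c \<le> m" "i \<in> I" for c i
    using assms(2)[of c] member_le_sum[of i I c] assms(1) that by simp
  hence "{c \<in> PiE I (\<lambda>_. UNIV). e c \<le> m} \<subseteq> PiE I (\<lambda>_. {..m})"
    by (auto simp: PiE_iff extensional_def)
  moreover have "finite (PiE I (\<lambda>_. {..m}))"
    using assms(1) by (intro finite_PiE) auto
  ultimately show "finite {c \<in> PiE I (\<lambda>_. UNIV). e c \<le> m}"
    using finite_subset by blast
qed

lemma fps_summable_nat_X_power2:
  assumes "\<And>i j. i \<le> e i j" "\<And>i j. j \<le> e i j"
  shows "fps_summable (\<lambda>(i, j). fps_X ^ e i j * g i j) (UNIV :: (nat \<times> nat) set)"
proof -
  have "fps_summable (\<lambda>p. fps_X ^ e (fst p) (snd p) * g (fst p) (snd p)) (UNIV :: (nat \<times> nat) set)"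
  proof (rule fps_summable_X_power)
    fix m
    have "{p \<in> UNIV. e (fst p) (snd p) \<le> m} \<subseteq> {..m} \<times> {..m}"
    proof
      fix p assume "p \<in> {p \<in> UNIV. e (fst p) (snd p) \<le> m}"
      thus "p \<in> {..m} \<times> {..m}"
        using assms(1)[of "fst p" "snd p"] assms(2)[where i = "fst p" and j = "snd p"] by (simp add: mem_Times_iff)
    qed
    thus "finite {p \<in> UNIV. e (fst p) (snd p) \<le> m}"
      using finite_subset by blast
  qed
  thus ?thesis by (simp add: case_prod_unfold)
qed

lemma fps_sum_nat_Suc:
  assumes "fps_summable f (UNIV :: nat set)"
  shows "fps_sum f UNIV = f 0 + fps_sum (\<lambda>n. f (Suc n)) UNIV"
proof (rule fps_ext)
  fix m
  have "finite {i. f i $ m \<noteq> 0}"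
    using assms by (simp add: fps_summable_def)
  then obtain M where M: "{i. f i $ m \<noteq> 0} \<subseteq> {..<M}"
    using finite_nat_iff_bounded by blast
  have 0: "f i $ m = 0" if "i \<ge> M" for i
  proof (rule ccontr)
    assume "f i $ m \<noteq> 0"
    with M have "i < M" by auto
    with that show False by simp
  qed
  have "fps_sum f UNIV $ m = (\<Sum>i<Suc M. f i $ m)"
    by (rule fps_sum_nth_eq) (auto simp: 0)
  also have "\<dots> = f 0 $ m + (\<Sum>i<M. f (Suc i) $ m)"
    by (rule sum.lessThan_Suc_shift)
  also have "(\<Sum>i<M. f (Suc i) $ m) = fps_sum (\<lambda>n. f (Suc n)) UNIV $ m"
    by (rule fps_sum_nth_eq[symmetric]) (auto simp: 0)
  finally show "fps_sum f UNIV $ m = (f 0 + fps_sum (\<lambda>n. f (Suc n)) UNIV) $ m"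
    by simp
qed

lemma fps_sum_nth_eq_0:
  "(\<And>i. i \<in> A \<Longrightarrow> f i $ m = 0) \<Longrightarrow> fps_sum f A $ m = 0"
  by (subst fps_sum_nth_eq[of "{}"]) auto

lemma fps_sum_sum_aux:
  assumes "finite B" "\<And>b. b \<in> B \<Longrightarrow> fps_summable (f b) A"
  shows "fps_summable (\<lambda>i. \<Sum>b\<in>B. f b i) A \<and>
         fps_sum (\<lambda>i. \<Sum>b\<in>B. f b i) A = (\<Sum>b\<in>B. fps_sum (f b) A)"
  using assms
proof (induction B)
  case empty
  then show ?case by (auto simp: fps_summable_def intro!: fps_ext fps_sum_nth_eq_0)
next
  case (insert b B)
  then show ?case by (simp add: fps_summable_add fps_sum_add)
qed

lemmas fps_sum_sum = fps_sum_sum_aux[THEN conjunct2]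

text \<open>The remainder \<open>U (Suc m)\<close> has no coefficient in degree m, so there is no
  boundary term at infinity.\<close>

lemma fps_sum_telescope:
  assumes "\<And>c l. l < c \<Longrightarrow> U c $ l = 0"
  shows "fps_sum (\<lambda>c. U c - U (Suc c)) UNIV = U 0"
proof (rule fps_ext)
  fix m
  have "fps_sum (\<lambda>c. U c - U (Suc c)) UNIV $ m = (\<Sum>c<Suc m. (U c - U (Suc c)) $ m)"
    by (rule fps_sum_nth_eq) (auto simp: assms)
  also have "\<dots> = (\<Sum>c<Suc m. U c $ m - U (Suc c) $ m)"
    by simp
  also have "\<dots> = U 0 $ m - U (Suc m) $ m"
    by (rule sum_lessThan_telescope')
  finally show "fps_sum (\<lambda>c. U c - U (Suc c)) UNIV $ m = U 0 $ m"
    by (simp add: assms)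
qed

section \<open>The chain sum\<close>

lemma qpoch_0 [simp]: "qpoch 0 = 1"
  by (simp add: qpoch_def)

lemma qpoch_Suc: "qpoch (Suc n) = qpoch n * (1 - fps_X ^ Suc n)"
  by (simp add: qpoch_def)

lemma qpoch_nth_0 [simp]: "qpoch n $ 0 = 1"
  by (induction n) (simp_all add: qpoch_Suc)

lemma qpoch_inverse [simp]: "qpoch n * inverse (qpoch n) = 1"
  by (simp add: inverse_mult_eq_1')

lemma one_minus_X_power_inverse [simp]:
  "(1 - fps_X ^ Suc n) * inverse (1 - fps_X ^ Suc n) = (1 :: rat fps)"
  by (rule inverse_mult_eq_1') simp

lemma inverse_qpoch_Suc:
  "(1 - fps_X ^ Suc n) * inverse (qpoch (Suc n)) = inverse (qpoch n)"
proof -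
  have "(1 - fps_X ^ Suc n) * inverse (qpoch (Suc n)) =
        (qpoch n * inverse (qpoch n)) * ((1 - fps_X ^ Suc n) * inverse (qpoch (Suc n)))"
    by simp
  also have "\<dots> = inverse (qpoch n) * (qpoch (Suc n) * inverse (qpoch (Suc n)))"
    by (simp only: qpoch_Suc mult_ac)
  finally show ?thesis by simp
qed

lemma inverse_qpoch_Suc': "inverse (qpoch (Suc n)) = inverse (qpoch n) * inverse (1 - fps_X ^ Suc n)"
proof -
  have "inverse (qpoch n) * inverse (1 - fps_X ^ Suc n) =
        ((1 - fps_X ^ Suc n) * inverse (1 - fps_X ^ Suc n)) * inverse (qpoch (Suc n))"
    by (subst inverse_qpoch_Suc[symmetric]) (simp only: mult_ac)
  thus ?thesis by (simp del: power_Suc)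
qed

text \<open>By Euler this is the product of (1 - q^j)^(-1) over all j \<ge> 1, the generating
  function of partitions. It enters the argument only as a common factor.\<close>

definition euler_series :: "rat fps" where
  "euler_series = fps_sum (\<lambda>n. fps_X ^ n * inverse (qpoch n)) UNIV"

text \<open>Write S(N) for the left side. Subtracting term by term leaves the factor 1 - q^n, which
  kills n = 0 and lowers (q)_n to (q)_(n-1); shifting n gives S(N) - S(N+1) = q^(N+1) S(N).\<close>

lemma fps_sum_euler:
  "fps_sum (\<lambda>n. fps_X ^ (n * (N + 1)) * inverse (qpoch n)) UNIV = qpoch N * euler_series"
proof (induction N)
  case 0
  then show ?case by (simp add: euler_series_def)
next
  case (Suc N)
  define F where "F N = (\<lambda>n. fps_X ^ (n * (N + 1)) * inverse (qpoch n))" for N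
  have F: "fps_summable (F N) UNIV" for N
    unfolding F_def by (rule fps_summable_nat_X_power) simp
  have diff: "F N n - F (Suc N) n = fps_X ^ (n * (N + 1)) * ((1 - fps_X ^ n) * inverse (qpoch n))" for n
    by (simp add: F_def algebra_simps power_add)
  have "fps_summable (\<lambda>n. F N n - F (Suc N) n) UNIV"
    unfolding diff by (rule fps_summable_nat_X_power) simp
  hence "fps_sum (\<lambda>n. F N n - F (Suc N) n) UNIV =
         (F N 0 - F (Suc N) 0) + fps_sum (\<lambda>n. F N (Suc n) - F (Suc N) (Suc n)) UNIV"
    by (rule fps_sum_nat_Suc)
  also have "F N 0 - F (Suc N) 0 = 0"
    by (simp add: F_def)
  also have "(\<lambda>n. F N (Suc n) - F (Suc N) (Suc n)) = (\<lambda>n. fps_X ^ (N + 1) * F N n)"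
    unfolding diff inverse_qpoch_Suc by (simp add: F_def fun_eq_iff power_add mult_ac)
  also have "fps_sum \<dots> UNIV = fps_X ^ (N + 1) * fps_sum (F N) UNIV"
    by (rule fps_sum_mult_left[OF F])
  finally have "fps_sum (F (Suc N)) UNIV = (1 - fps_X ^ (N + 1)) * fps_sum (F N) UNIV"
    by (simp add: fps_sum_diff F algebra_simps)
  thus ?case
    using Suc by (simp add: F_def qpoch_Suc mult_ac)
qed

lemma fps_sum_geometric:
  "fps_sum (\<lambda>n. fps_X ^ (n * Suc m)) UNIV = inverse (1 - fps_X ^ Suc m :: rat fps)"
proof -
  let ?g = "fps_sum (\<lambda>n. fps_X ^ (n * Suc m)) UNIV :: rat fps"
  have s: "fps_summable (\<lambda>n. fps_X ^ (n * Suc m) :: rat fps) UNIV"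
    using fps_summable_nat_X_power[of "\<lambda>n. n * Suc m" "\<lambda>_. 1"] by simp
  have "(1 - fps_X ^ Suc m) * ?g = fps_sum (\<lambda>n. (1 - fps_X ^ Suc m) * fps_X ^ (n * Suc m)) UNIV"
    by (rule fps_sum_mult_left[OF s, symmetric])
  also have "(\<lambda>n. (1 - fps_X ^ Suc m) * fps_X ^ (n * Suc m)) =
             (\<lambda>n. fps_X ^ (n * Suc m) - fps_X ^ (Suc n * Suc m) :: rat fps)"
    by (simp add: fun_eq_iff algebra_simps power_add)
  also have "fps_sum \<dots> UNIV = fps_X ^ (0 * Suc m)"
    by (rule fps_sum_telescope) auto
  finally have "(1 - fps_X ^ Suc m) * ?g = 1"
    by simp
  hence "inverse (1 - fps_X ^ Suc m) * ((1 - fps_X ^ Suc m) * ?g) = inverse (1 - fps_X ^ Suc m)"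
    by simp
  thus ?thesis
    by (simp add: mult.assoc[symmetric] mult.commute[of "inverse _"] del: power_Suc)
qed

text \<open>A case of the q-binomial theorem, with argument q^(S+1). Splitting the factor 1 -
  q^(c+b+1) of (q)_(c+b+1) produces the sums for (c, S) and (c, S+1), which is why S is arbitrary in
  the induction on c.\<close>

lemma fps_sum_qpoch_ratio:
  "fps_sum (\<lambda>b. fps_X ^ (b * (S + 1)) * (qpoch (c + b) * inverse (qpoch b))) UNIV
     = qpoch c * qpoch S * inverse (qpoch (Suc (c + S)))"
proof (induction c arbitrary: S)
  case 0
  have "qpoch S * inverse (qpoch (Suc S)) = inverse (1 - fps_X ^ Suc S)"
    by (simp add: inverse_qpoch_Suc' mult.assoc[symmetric] del: power_Suc)
  thus ?case
    using fps_sum_geometric[of S] by (simp del: power_Suc)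
next
  case (Suc c)
  define P where "P S = (\<lambda>b. fps_X ^ (b * (S + 1)) * (qpoch (c + b) * inverse (qpoch b)))" for S
  have P: "fps_summable (P S) UNIV" for S
    unfolding P_def by (rule fps_summable_nat_X_power) simp
  have "(\<lambda>b. fps_X ^ (b * (S + 1)) * (qpoch (Suc c + b) * inverse (qpoch b))) =
        (\<lambda>b. P S b - fps_X ^ Suc c * P (Suc S) b)"
    by (simp add: P_def fun_eq_iff qpoch_Suc algebra_simps power_add)
  hence "fps_sum (\<lambda>b. fps_X ^ (b * (S + 1)) * (qpoch (Suc c + b) * inverse (qpoch b))) UNIV =
         fps_sum (P S) UNIV - fps_X ^ Suc c * fps_sum (P (Suc S)) UNIV"
    by (simp add: fps_sum_diff fps_sum_mult_left fps_summable_mult_left P del: power_Suc)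
  also have "fps_sum (P S) UNIV = qpoch c * qpoch S * inverse (qpoch (Suc (c + S)))"
    unfolding P_def by (rule Suc.IH)
  also have "fps_sum (P (Suc S)) UNIV = qpoch c * qpoch (Suc S) * inverse (qpoch (Suc (c + Suc S)))"
    unfolding P_def by (rule Suc.IH)
  \<comment> \<open>This brings both terms over the denominator (q)_(c+S+2); they combine by (1 -
    q^(c+S+2)) - q^(c+1) (1 - q^(S+1)) = 1 - q^(c+1).\<close>
  also have "inverse (qpoch (Suc (c + S))) =
             (1 - fps_X ^ Suc (Suc (c + S))) * inverse (qpoch (Suc (Suc (c + S))))"
    by (rule inverse_qpoch_Suc[symmetric])
  finally show ?case
    by (simp add: qpoch_Suc algebra_simps power_add)
qed

text \<open>The negative binomial series at x = q^(m+1). By Pascal's rule the sums satisfy G_(k+1) =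
  x G_(k+1) + G_k, so each step in k divides by 1 - x.\<close>

lemma fps_sum_binomial:
  "fps_sum (\<lambda>r. of_nat (r + k - 1 choose r) * fps_X ^ (r * Suc m)) UNIV =
     (inverse (1 - fps_X ^ Suc m) ^ k :: rat fps)"
proof (induction k)
  case 0
  \<comment> \<open>For k = 0 truncated subtraction gives 0 choose 0 = 1 at r = 0, and r - 1 choose
    r = 0 for r > 0, so the series is 1.\<close>
  have "fps_sum (\<lambda>r. of_nat (r + 0 - 1 choose r) * fps_X ^ (r * Suc m)) UNIV =
        (1 :: rat fps) + fps_sum (\<lambda>r. of_nat (Suc r + 0 - 1 choose Suc r) * fps_X ^ (Suc r * Suc m)) UNIV"
    by (subst fps_sum_nat_Suc)
       (use fps_summable_nat_X_power[of "\<lambda>r. r * Suc m" "\<lambda>r. of_nat (r + 0 - 1 choose r)"]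
        in \<open>simp_all add: mult.commute\<close>)
  also have "fps_sum (\<lambda>r. of_nat (Suc r + 0 - 1 choose Suc r) * fps_X ^ (Suc r * Suc m) :: rat fps) UNIV = 0"
    by (intro fps_ext) (simp add: fps_sum_nth_eq_0)
  finally show ?case by simp
next
  case (Suc k)
  define G :: "nat \<Rightarrow> nat \<Rightarrow> rat fps"
    where "G k = (\<lambda>r. of_nat (r + k - 1 choose r) * fps_X ^ (r * Suc m))" for k
  have G: "fps_summable (G k) UNIV" for k
    using fps_summable_nat_X_power[of "\<lambda>r. r * Suc m" "\<lambda>r. of_nat (r + k - 1 choose r)" UNIV]
    unfolding G_def by (simp add: mult.commute)
  have G': "fps_summable (\<lambda>r. G k (Suc r)) UNIV" for k
    using fps_summable_nat_X_power[of "\<lambda>r. Suc r * Suc m" "\<lambda>r. of_nat (Suc r + k - 1 choose Suc r)" UNIV]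
    unfolding G_def by (simp add: mult.commute)
  have G0: "G k 0 = 1" for k
    by (simp add: G_def)
  have "G (Suc k) (Suc r) = fps_X ^ Suc m * G (Suc k) r + G k (Suc r)" for r
    by (simp add: G_def algebra_simps power_add)
  hence "fps_sum (G (Suc k)) UNIV =
         G (Suc k) 0 + fps_sum (\<lambda>r. fps_X ^ Suc m * G (Suc k) r + G k (Suc r)) UNIV"
    using fps_sum_nat_Suc[OF G] by simp
  also have "\<dots> = fps_X ^ Suc m * fps_sum (G (Suc k)) UNIV + (G k 0 + fps_sum (\<lambda>r. G k (Suc r)) UNIV)"
    by (subst fps_sum_add)
       (simp_all add: G G' G0 fps_summable_mult_left fps_sum_mult_left del: power_Suc)
  also have "G k 0 + fps_sum (\<lambda>r. G k (Suc r)) UNIV = fps_sum (G k) UNIV"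
    by (rule fps_sum_nat_Suc[OF G, symmetric])
  finally have "(1 - fps_X ^ Suc m) * fps_sum (G (Suc k)) UNIV = inverse (1 - fps_X ^ Suc m) ^ k"
    using Suc.IH by (simp add: G_def algebra_simps)
  hence "inverse (1 - fps_X ^ Suc m) * ((1 - fps_X ^ Suc m) * fps_sum (G (Suc k)) UNIV) =
         inverse (1 - fps_X ^ Suc m) ^ Suc k"
    by simp
  thus ?case
    by (simp add: G_def mult.assoc[symmetric] mult.commute[of "inverse _" "1 - _"] del: power_Suc)
qed

text \<open>The functions $t_r(j)$; the recurrence \<open>tri_Suc\<close> is what makes \<open>chain_eq\<close> telescope.\<close>

definition tri :: "nat \<Rightarrow> nat \<Rightarrow> rat fps" where
  "tri r j = fps_X ^ (r + j) * (qpoch r * (\<Sum>b\<le>r. fps_X ^ (j * b) * inverse (qpoch (r - b))))"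

lemma tri_0 [simp]: "tri 0 j = fps_X ^ j"
  by (simp add: tri_def)

text \<open>The factor 1 - q^(r+1) of (q)_(r+1) is split as (1 - q^b) + q^b (1 - q^(r+1-b)). The
  factor 1 - q^(r+1-b) lowers the denominator, while 1 - q^b removes the term b = 0 and permits a
  shift of b. In terms of the operator D the recurrence says t_(r+1) = (1 - D) t_r.\<close>

lemma tri_Suc:
  "tri (Suc r) j = fps_X ^ Suc j * tri r j + (1 - fps_X ^ Suc j) * tri r (Suc j)"
proof -
  define c where "c b = inverse (qpoch (r - b))" for b
  define d where "d b = inverse (qpoch (Suc r - b))" for b
  have d: "d (Suc b) = c b" for b
    by (simp add: c_def d_def)
  have cd: "(1 - fps_X ^ (Suc r - b)) * d b = c b" if "b \<le> r" for b
    using inverse_qpoch_Suc[of "r - b"] that by (simp add: c_def d_def Suc_diff_le del: power_Suc)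
  have "(1 - fps_X ^ Suc r) * (\<Sum>b\<le>Suc r. fps_X ^ (j * b) * d b) =
        (\<Sum>b\<le>Suc r. fps_X ^ (j * b) * (1 - fps_X ^ b) * d b
                    + fps_X ^ (j * b) * fps_X ^ b * ((1 - fps_X ^ (Suc r - b)) * d b))"
    unfolding sum_distrib_left
  proof (rule sum.cong)
    fix b assume "b \<in> {..Suc r}"
    hence "(fps_X :: rat fps) ^ Suc r = fps_X ^ b * fps_X ^ (Suc r - b)"
      by (simp flip: power_add del: power_Suc)
    thus "(1 - fps_X ^ Suc r) * (fps_X ^ (j * b) * d b) =
          fps_X ^ (j * b) * (1 - fps_X ^ b) * d b
            + fps_X ^ (j * b) * fps_X ^ b * ((1 - fps_X ^ (Suc r - b)) * d b)"
      by (simp only: algebra_simps mult_1_left)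
  qed auto
  also have "\<dots> = (\<Sum>b\<le>Suc r. fps_X ^ (j * b) * (1 - fps_X ^ b) * d b)
               + (\<Sum>b\<le>Suc r. fps_X ^ (j * b) * fps_X ^ b * ((1 - fps_X ^ (Suc r - b)) * d b))"
    by (rule sum.distrib)
  also have "(\<Sum>b\<le>Suc r. fps_X ^ (j * b) * (1 - fps_X ^ b) * d b) =
             fps_X ^ j * (\<Sum>b\<le>r. fps_X ^ (j * b) * (1 - fps_X ^ Suc b) * c b)"
    by (subst sum.atMost_Suc_shift) (simp add: d sum_distrib_left power_add mult_ac del: power_Suc)
  also have "(\<Sum>b\<le>Suc r. fps_X ^ (j * b) * fps_X ^ b * ((1 - fps_X ^ (Suc r - b)) * d b)) =
             (\<Sum>b\<le>r. fps_X ^ (j * b) * fps_X ^ b * c b)"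
    by (simp add: cd)
  finally have *: "(1 - fps_X ^ Suc r) * (\<Sum>b\<le>Suc r. fps_X ^ (j * b) * d b) =
    fps_X ^ j * (\<Sum>b\<le>r. fps_X ^ (j * b) * c b) + (1 - fps_X ^ Suc j) * (\<Sum>b\<le>r. fps_X ^ (Suc j * b) * c b)"
    by (simp add: sum_distrib_left sum_subtractf power_add algebra_simps)
  have "tri (Suc r) j = fps_X ^ (Suc r + j) * qpoch r * ((1 - fps_X ^ Suc r) * (\<Sum>b\<le>Suc r. fps_X ^ (j * b) * d b))"
    by (simp only: tri_def d_def qpoch_Suc mult_ac)
  also have "\<dots> = fps_X ^ Suc j * tri r j + (1 - fps_X ^ Suc j) * tri r (Suc j)"
    unfolding * by (simp add: tri_def c_def[symmetric] algebra_simps power_add)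
  finally show ?thesis .
qed

text \<open>Partitions with parts at most n, sorted by their largest part i; formally, 1/(q)_n -
  1/(q)_(n-1) = q^n/(q)_n.\<close>

lemma sum_X_power_inverse_qpoch:
  "(\<Sum>i\<le>n. fps_X ^ i * inverse (qpoch i)) = inverse (qpoch n)"
proof (induction n)
  case (Suc n)
  have "(\<Sum>i\<le>Suc n. fps_X ^ i * inverse (qpoch i)) =
        (1 - fps_X ^ Suc n) * inverse (qpoch (Suc n)) + fps_X ^ Suc n * inverse (qpoch (Suc n))"
    using Suc by (simp add: inverse_qpoch_Suc del: power_Suc)
  thus ?case by (simp add: algebra_simps)
qed simp

text \<open>Passing from r to r+1 raises the value by exactly 1. By 1 - q^(r+2) = (1 - q^(r+1-b)) +
  q^(r+1-b) (1 - q^(b+1)), the term with index b grows by (q)_(r+1) q^(r+1-b)/(q)_(r+1-b); these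
  increments and the new term b = r+1 sum to 1 by \<open>sum_X_power_inverse_qpoch\<close>. The
  factor r+1 of the chain side originates here.\<close>

lemma sum_qpoch_ratio:
  "(\<Sum>b\<le>r. qpoch (Suc r) * inverse (qpoch (r - b)) * inverse (1 - fps_X ^ Suc b)) = of_nat (Suc r)"
proof (induction r)
  case 0
  then show ?case using one_minus_X_power_inverse[of 0] by (simp add: qpoch_Suc)
next
  case (Suc r)
  have "qpoch (Suc (Suc r)) * inverse (qpoch (Suc r - b)) * inverse (1 - fps_X ^ Suc b) =
        qpoch (Suc r) * inverse (qpoch (r - b)) * inverse (1 - fps_X ^ Suc b)
          + qpoch (Suc r) * (fps_X ^ (Suc r - b) * inverse (qpoch (Suc r - b)))"
    if "b \<le> r" for b
  proof -
    define u where "u = inverse (qpoch (Suc (r - b)))"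
    define w where "w = inverse (1 - fps_X ^ Suc b :: rat fps)"
    have 1: "inverse (qpoch (r - b)) = (1 - fps_X ^ Suc (r - b)) * u"
      unfolding u_def by (rule inverse_qpoch_Suc[symmetric])
    have 2: "(1 - fps_X ^ Suc b) * w = 1"
      unfolding w_def by (rule one_minus_X_power_inverse)
    have 3: "(fps_X :: rat fps) ^ Suc (Suc r) = fps_X ^ Suc (r - b) * fps_X ^ Suc b"
      using that by (simp flip: power_add del: power_Suc)
    have "qpoch (Suc (Suc r)) * u * w =
          qpoch (Suc r) * ((1 - fps_X ^ Suc (r - b)) * u) * w
            + qpoch (Suc r) * (fps_X ^ Suc (r - b) * u) * ((1 - fps_X ^ Suc b) * w)"
      unfolding qpoch_Suc[of "Suc r"] 3 by (simp only: algebra_simps mult_1_left)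
    thus ?thesis
      using that unfolding 2 by (simp add: 1 u_def[symmetric] w_def[symmetric] Suc_diff_le del: power_Suc)
  qed
  hence "(\<Sum>b\<le>r. qpoch (Suc (Suc r)) * inverse (qpoch (Suc r - b)) * inverse (1 - fps_X ^ Suc b)) =
         of_nat (Suc r) + qpoch (Suc r) * (\<Sum>b\<le>r. fps_X ^ (Suc r - b) * inverse (qpoch (Suc r - b)))"
    by (simp add: sum.distrib sum_distrib_left flip: Suc.IH del: power_Suc of_nat_Suc)
  \<comment> \<open>The new term b = r+1 equals (q)_(r+1), which supplies the summand still missing
    at b = r+1 in the sum of q^(r+1-b)/(q)_(r+1-b).\<close>
  hence "(\<Sum>b\<le>Suc r. qpoch (Suc (Suc r)) * inverse (qpoch (Suc r - b)) * inverse (1 - fps_X ^ Suc b)) =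
         of_nat (Suc r) + qpoch (Suc r) * (\<Sum>b\<le>r. fps_X ^ (Suc r - b) * inverse (qpoch (Suc r - b)))
           + qpoch (Suc r) * ((1 - fps_X ^ Suc (Suc r)) * inverse (1 - fps_X ^ Suc (Suc r)))"
    by (simp add: qpoch_Suc[of "Suc r"] mult.assoc del: power_Suc of_nat_Suc one_minus_X_power_inverse)
  also have "\<dots> = of_nat (Suc r) + qpoch (Suc r) * (\<Sum>b\<le>Suc r. fps_X ^ (Suc r - b) * inverse (qpoch (Suc r - b)))"
    unfolding one_minus_X_power_inverse by (simp add: distrib_left del: power_Suc of_nat_Suc)
  also have "(\<Sum>b\<le>Suc r. fps_X ^ (Suc r - b) * inverse (qpoch (Suc r - b))) =
             (\<Sum>i\<le>Suc r. fps_X ^ i * inverse (qpoch i))"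
    by (rule sum.nat_diff_reindex[of "\<lambda>i. fps_X ^ i * inverse (qpoch i)" "Suc (Suc r)", simplified lessThan_Suc_atMost diff_Suc_Suc])
  also have "\<dots> = inverse (qpoch (Suc r))"
    by (rule sum_X_power_inverse_qpoch)
  finally show ?case by (simp add: add.commute)
qed

text \<open>For fixed b the dependence on j is q^(j(b+1)), a geometric series; the finite sum over b
  that remains is the one in \<open>sum_qpoch_ratio\<close>.\<close>

lemma fps_sum_tri:
  "fps_sum (tri r) UNIV = of_nat (Suc r) * (fps_X ^ r * inverse (1 - fps_X ^ Suc r))"
proof -
  define f where "f b = (\<lambda>j. fps_X ^ r * qpoch r * inverse (qpoch (r - b)) * (fps_X ^ (j * Suc b) :: rat fps))"
    for b
  have s: "fps_summable (\<lambda>j. fps_X ^ (j * Suc b) :: rat fps) UNIV" for b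
    using fps_summable_nat_X_power[of "\<lambda>j. j * Suc b" "\<lambda>_. 1"] by simp
  have sf: "fps_summable (f b) UNIV" for b
    unfolding f_def by (rule fps_summable_mult_left[OF s])
  have "tri r = (\<lambda>j. \<Sum>b\<le>r. f b j)"
    by (simp add: tri_def f_def fun_eq_iff sum_distrib_left power_add mult_ac)
  hence "fps_sum (tri r) UNIV = (\<Sum>b\<le>r. fps_sum (f b) UNIV)"
    by (simp add: fps_sum_sum sf)
  also have "\<dots> = (\<Sum>b\<le>r. fps_X ^ r * inverse (1 - fps_X ^ Suc r) *
       (qpoch (Suc r) * inverse (qpoch (r - b)) * inverse (1 - fps_X ^ Suc b)))"
  proof (rule sum.cong)
    fix b
    have "fps_sum (f b) UNIV = fps_X ^ r * qpoch r * inverse (qpoch (r - b)) * inverse (1 - fps_X ^ Suc b)"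
      unfolding f_def fps_sum_mult_left[OF s] fps_sum_geometric ..
    also have "qpoch r = qpoch (Suc r) * inverse (1 - fps_X ^ Suc r)"
      by (simp add: qpoch_Suc mult.assoc del: power_Suc)
    finally show "fps_sum (f b) UNIV = fps_X ^ r * inverse (1 - fps_X ^ Suc r) *
       (qpoch (Suc r) * inverse (qpoch (r - b)) * inverse (1 - fps_X ^ Suc b))"
      by (simp only: mult_ac)
  qed auto
  also have "\<dots> = of_nat (Suc r) * (fps_X ^ r * inverse (1 - fps_X ^ Suc r))"
    unfolding sum_distrib_left[symmetric] sum_qpoch_ratio by (rule mult.commute)
  finally show ?thesis .
qed

text \<open>
  \<open>chain k j\<close> is the sum of $q^{S_0} \prod_{s<k} (1-q^{S_s+1})^{-1}$ over all
  $S_0 \ge \dots \ge S_{k-1} \ge S_k = j$.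
\<close>

fun chain :: "nat \<Rightarrow> nat \<Rightarrow> rat fps" where
  "chain 0 j = fps_X ^ j"
| "chain (Suc k) j = fps_sum (\<lambda>c. inverse (1 - fps_X ^ Suc (j + c)) * chain k (j + c)) UNIV"

text \<open>\<open>tri (g r) j\<close> is divisible by q^(g r + j). The map g covers both
  \<open>tri r j\<close> and the shifted \<open>tri (Suc r) j\<close>.\<close>

lemma fps_summable_binomial_tri:
  "fps_summable (\<lambda>r. of_nat (f r) * tri (g r) j) UNIV" if "\<And>r. r \<le> g r"
proof -
  have "fps_summable (\<lambda>r. fps_X ^ (g r + j) * (of_nat (f r) *
          (qpoch (g r) * (\<Sum>b\<le>g r. fps_X ^ (j * b) * inverse (qpoch (g r - b)))))) UNIV"
    using that by (intro fps_summable_nat_X_power) (simp add: trans_le_add1)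
  thus ?thesis by (simp add: tri_def mult_ac)
qed

text \<open>With W_k(j) for the right side, Pascal's rule and \<open>tri_Suc\<close> give W_k(j) =
  (1 - q^(j+1)) (W_(k+1)(j) - W_(k+1)(j+1)). After division by 1 - q^(j+1), the sum defining the
  chain with k+1 links telescopes to W_(k+1)(j).\<close>

lemma chain_eq:
  "chain k j = fps_sum (\<lambda>r. of_nat (r + k - 1 choose r) * tri r j) UNIV"
proof (induction k arbitrary: j)
  case 0
  have "fps_sum (\<lambda>r. of_nat (r + 0 - 1 choose r) * tri r j) UNIV =
        fps_X ^ j + fps_sum (\<lambda>r. of_nat (Suc r + 0 - 1 choose Suc r) * tri (Suc r) j) UNIV"
    by (subst fps_sum_nat_Suc[OF fps_summable_binomial_tri]) simp_all
  also have "fps_sum (\<lambda>r. of_nat (Suc r + 0 - 1 choose Suc r) * tri (Suc r) j) UNIV = 0"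
    by (intro fps_ext) (simp add: fps_sum_nth_eq_0)
  finally show ?case by simp
next
  case (Suc k)
  define W where "W k j = fps_sum (\<lambda>r. of_nat (r + k - 1 choose r) * tri r j) UNIV" for k j
  have s: "fps_summable (\<lambda>r. of_nat (r + k choose r) * tri r j) UNIV" for j
    by (rule fps_summable_binomial_tri) simp
  have s': "fps_summable (\<lambda>r. of_nat (f r) * tri (Suc r) j) UNIV" for f j
    by (rule fps_summable_binomial_tri) simp
  have W: "W (Suc k) j = W k j + (fps_X ^ Suc j * W (Suc k) j + (1 - fps_X ^ Suc j) * W (Suc k) (Suc j))" for j
  proof -
    have "W (Suc k) j = fps_X ^ j + fps_sum (\<lambda>r. of_nat (Suc r + k choose Suc r) * tri (Suc r) j) UNIV"
      unfolding W_def by (subst fps_sum_nat_Suc[OF fps_summable_binomial_tri]) simp_all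
    \<comment> \<open>Pascal's rule. The first part, with the term r = 0 put back, is
      \<open>W k j\<close>; the second already has the coefficients of \<open>W (Suc k)\<close> at
      index r, so \<open>tri_Suc\<close> can be applied under the sum.\<close>
    also have "(\<lambda>r. of_nat (Suc r + k choose Suc r) * tri (Suc r) j) =
               (\<lambda>r. of_nat (Suc r + k - 1 choose Suc r) * tri (Suc r) j + of_nat (r + k choose r) * tri (Suc r) j)"
      by (simp add: fun_eq_iff algebra_simps)
    also have "fps_sum \<dots> UNIV =
               fps_sum (\<lambda>r. of_nat (Suc r + k - 1 choose Suc r) * tri (Suc r) j) UNIV +
               fps_sum (\<lambda>r. of_nat (r + k choose r) * tri (Suc r) j) UNIV"
      by (rule fps_sum_add[OF s' s'])
    also have "fps_X ^ j + (fps_sum (\<lambda>r. of_nat (Suc r + k - 1 choose Suc r) * tri (Suc r) j) UNIV +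
               fps_sum (\<lambda>r. of_nat (r + k choose r) * tri (Suc r) j) UNIV) =
               W k j + fps_sum (\<lambda>r. of_nat (r + k choose r) * tri (Suc r) j) UNIV"
      unfolding W_def by (subst (3) fps_sum_nat_Suc[OF fps_summable_binomial_tri]) simp_all
    also have "(\<lambda>r. of_nat (r + k choose r) * tri (Suc r) j) =
               (\<lambda>r. fps_X ^ Suc j * (of_nat (r + k choose r) * tri r j) +
                    (1 - fps_X ^ Suc j) * (of_nat (r + k choose r) * tri r (Suc j)))"
      unfolding tri_Suc by (simp only: fun_eq_iff distrib_left mult_ac) simp
    also have "fps_sum \<dots> UNIV = fps_X ^ Suc j * W (Suc k) j + (1 - fps_X ^ Suc j) * W (Suc k) (Suc j)"
      by (simp add: fps_sum_add fps_summable_mult_left fps_sum_mult_left s W_def del: power_Suc)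
    finally show ?thesis .
  qed
  have diff: "inverse (1 - fps_X ^ Suc j) * W k j = W (Suc k) j - W (Suc k) (Suc j)" for j
  proof -
    have "W k j = (1 - fps_X ^ Suc j) * (W (Suc k) j - W (Suc k) (Suc j))"
      using W[of j] by (simp only: algebra_simps) (simp add: algebra_simps)
    hence "inverse (1 - fps_X ^ Suc j) * W k j =
           (1 - fps_X ^ Suc j) * inverse (1 - fps_X ^ Suc j) * (W (Suc k) j - W (Suc k) (Suc j))"
      by (simp only: mult_ac)
    thus ?thesis by (simp del: power_Suc)
  qed
  \<comment> \<open>Each \<open>tri r (j + c)\<close> is divisible by q^(r+j+c), so the telescoping
    sum has no contribution from infinity.\<close>
  have zero: "W (Suc k) (j + c) $ l = 0" if "l < c" for c l
    unfolding W_def using that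
    by (intro fps_sum_nth_eq_0)
       (simp add: tri_def mult.left_commute[of "of_nat _"] fps_X_power_mult_nth)
  have "chain (Suc k) j = fps_sum (\<lambda>c. W (Suc k) (j + c) - W (Suc k) (j + Suc c)) UNIV"
    unfolding chain.simps Suc.IH W_def[symmetric] diff by simp
  also have "\<dots> = W (Suc k) j"
    by (subst fps_sum_telescope[OF zero]) simp_all
  finally show ?case by (simp add: W_def)
qed

text \<open>Divisibility of \<open>tri r j\<close> by q^(r+j) makes the family summable over j and r
  jointly, so the sum over j can be carried out first.\<close>

lemma fps_sum_chain:
  "fps_sum (chain k) UNIV =
     fps_sum (\<lambda>r. of_nat (r + k - 1 choose r) * of_nat (Suc r) * (fps_X ^ r * inverse (1 - fps_X ^ Suc r))) UNIV"
proof -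
  have "fps_summable (\<lambda>(j, r). fps_X ^ (r + j) * (of_nat (r + k - 1 choose r) *
          (qpoch r * (\<Sum>b\<le>r. fps_X ^ (j * b) * inverse (qpoch (r - b)))))) UNIV"
    by (rule fps_summable_nat_X_power2) simp_all
  hence s: "fps_summable (\<lambda>(j, r). of_nat (r + k - 1 choose r) * tri r j) (UNIV \<times> UNIV)"
    by (simp add: tri_def mult_ac)
  have s': "fps_summable (tri r) UNIV" for r
    unfolding tri_def by (rule fps_summable_nat_X_power) simp
  have "chain k = (\<lambda>j. fps_sum (\<lambda>r. of_nat (r + k - 1 choose r) * tri r j) UNIV)"
    by (simp add: fun_eq_iff chain_eq)
  hence "fps_sum (chain k) UNIV = fps_sum (\<lambda>r. fps_sum (\<lambda>j. of_nat (r + k - 1 choose r) * tri r j) UNIV) UNIV"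
    using fps_sum_swap[OF s] by simp
  thus ?thesis
    unfolding fps_sum_mult_left[OF s'] fps_sum_tri by (simp only: mult.assoc)
qed

section \<open>The tree sum and the comparison of coefficients\<close>

definition star_series :: "nat \<Rightarrow> rat fps" where
  "star_series k = fps_sum (\<lambda>n. fps_X ^ n * inverse (1 - fps_X ^ Suc n) ^ k) UNIV"

text \<open>After expanding the k-th power the exponent is n + r(n+1) = r + n(r+1), symmetric in n
  and r. Summing over n first leaves a geometric series of ratio q^(r+1).\<close>

lemma star_series_eq:
  "star_series k =
     fps_sum (\<lambda>r. of_nat (r + k - 1 choose r) * (fps_X ^ r * inverse (1 - fps_X ^ Suc r))) UNIV"
proof -
  define f :: "nat \<Rightarrow> nat \<Rightarrow> rat fps"
    where "f n r = of_nat (r + k - 1 choose r) * fps_X ^ r * fps_X ^ (n * Suc r)" for n r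
  have "fps_summable (\<lambda>(n, r). fps_X ^ (n + r + n * r) * of_nat (r + k - 1 choose r) :: rat fps) UNIV"
    by (rule fps_summable_nat_X_power2) simp_all
  moreover have "(\<lambda>(n, r). fps_X ^ (n + r + n * r) * of_nat (r + k - 1 choose r)) = (\<lambda>(n, r). f n r)"
    by (simp add: f_def fun_eq_iff power_add mult_ac)
  ultimately have s: "fps_summable (\<lambda>(n, r). f n r) (UNIV \<times> UNIV)"
    by simp
  have s': "fps_summable (\<lambda>n. fps_X ^ (n * Suc r) :: rat fps) UNIV" for r
    using fps_summable_nat_X_power[of "\<lambda>n. n * Suc r" "\<lambda>_. 1"] by simp
  have s'': "fps_summable (\<lambda>r. of_nat (r + k - 1 choose r) * fps_X ^ (r * Suc n) :: rat fps) UNIV" for n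
    using fps_summable_nat_X_power[of "\<lambda>r. r * Suc n" "\<lambda>r. of_nat (r + k - 1 choose r)" UNIV]
    by (simp add: mult.commute)
  have "f n = (\<lambda>r. fps_X ^ n * (of_nat (r + k - 1 choose r) * fps_X ^ (r * Suc n)))" for n
    by (simp add: f_def fun_eq_iff power_add mult_ac)
  hence "fps_sum (f n) UNIV = fps_X ^ n * inverse (1 - fps_X ^ Suc n) ^ k" for n
    by (simp only: fps_sum_mult_left[OF s''] fps_sum_binomial)
  hence "star_series k = fps_sum (\<lambda>n. fps_sum (f n) UNIV) UNIV"
    by (simp add: star_series_def)
  also have "\<dots> = fps_sum (\<lambda>r. fps_sum (\<lambda>n. f n r) UNIV) UNIV"
    by (rule fps_sum_swap[OF s])
  finally show ?thesis
    unfolding f_def fps_sum_mult_left[OF s'] fps_sum_geometric by (simp only: mult.assoc)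
qed

text \<open>In terms of beta_k(r) = binom(r+k-1, r) this is k beta_(k+1)(r) = (r+k) beta_k(r), the
  coefficient identity behind the claim, written without subtraction.\<close>

lemma times_binomial_shift: "k * (r + k choose r) = (r + k) * (r + k - 1 choose r)"
  using binomial_absorb_comp[of "r + k" r] by simp

lemma fps_sum_chain_star_series:
  "fps_sum (chain k) UNIV = of_nat k * star_series (Suc k) - (of_nat k - 1) * star_series k"
proof -
  define g :: "nat \<Rightarrow> rat fps" where "g r = fps_X ^ r * inverse (1 - fps_X ^ Suc r)" for r
  have s: "fps_summable (\<lambda>r. of_nat (r + l - 1 choose r) * g r) UNIV" for l
    using fps_summable_nat_X_power[of "\<lambda>r. r" "\<lambda>r. of_nat (r + l - 1 choose r) * inverse (1 - fps_X ^ Suc r)" UNIV]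
    by (simp add: g_def mult_ac)
  have "of_nat k * (of_nat (r + Suc k - 1 choose r) * g r) - (of_nat k - 1) * (of_nat (r + k - 1 choose r) * g r)
        = of_nat (r + k - 1 choose r) * of_nat (Suc r) * g r" for r
  proof -
    have "(of_nat k * of_nat (r + k choose r) :: rat fps) = (of_nat r + of_nat k) * of_nat (r + k - 1 choose r)"
      using arg_cong[OF times_binomial_shift[of k r], of "of_nat :: nat \<Rightarrow> rat fps"] by simp
    hence "of_nat k * (of_nat (r + k choose r) * g r) = (of_nat r + of_nat k) * of_nat (r + k - 1 choose r) * g r"
      by (simp only: mult.assoc[symmetric])
    thus ?thesis by (simp add: algebra_simps)
  qed
  hence "fps_sum (chain k) UNIV = fps_sum (\<lambda>r. of_nat k * (of_nat (r + Suc k - 1 choose r) * g r)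
            - (of_nat k - 1) * (of_nat (r + k - 1 choose r) * g r)) UNIV"
    unfolding fps_sum_chain g_def by simp
  also have "\<dots> = of_nat k * star_series (Suc k) - (of_nat k - 1) * star_series k"
    unfolding star_series_eq g_def[symmetric] using s[of "Suc k"] s[of k]
    by (simp only: fps_sum_diff fps_sum_mult_left fps_summable_mult_left)
  finally show ?thesis .
qed

section \<open>Graph series\<close>

lemma graph_term_eq:
  "graph_term G n = fps_X ^ graph_exponent G n * (\<Prod>i\<in>pverts G. inverse (qpoch (n i)))"
proof -
  have *: "(\<Prod>i\<in>V. qpoch (n i)) * (\<Prod>i\<in>V. inverse (qpoch (n i))) = 1" for V
    by (simp flip: prod.distrib)
  have 0: "(\<Prod>i\<in>pverts G. qpoch (n i)) $ 0 = 1"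
    by (simp add: fps_nth_0_prod)
  have "inverse (\<Prod>i\<in>pverts G. qpoch (n i)) = (\<Prod>i\<in>pverts G. inverse (qpoch (n i)))"
    using * by (intro fps_inverse_unique) (simp add: mult.commute)
  thus ?thesis
    unfolding graph_term_def using 0 by (subst fps_divide_unit) auto
qed

lemma graph_term_summable': "finite (pverts G) \<Longrightarrow> fps_summable (graph_term G) (pverts G \<rightarrow>\<^sub>E UNIV)"
  unfolding graph_term_eq
  by (rule fps_summable_PiE_X_power) (simp_all add: graph_exponent_def)

text \<open>Terms of exponent above m do not reach coefficient m, so the q-adic limit and the formal
  sum both reduce to the finitely many n of exponent at most m.\<close>

lemma graph_series_eq:
  assumes "finite (pverts G)"
  shows "graph_series G = fps_sum (graph_term G) (pverts G \<rightarrow>\<^sub>E UNIV)"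
proof (rule fps_ext)
  fix m
  have "graph_series G $ m = (\<Sum>n | n \<in> (pverts G \<rightarrow>\<^sub>E UNIV) \<and> graph_exponent G n \<le> m. graph_term G n $ m)"
    unfolding graph_series_def using infsumI[OF graph_term_has_sum[OF assms]] by simp
  also have "\<dots> = fps_sum (graph_term G) (pverts G \<rightarrow>\<^sub>E UNIV) $ m"
    by (rule fps_sum_nth_eq[symmetric])
       (use finite_graph_exponent_le[OF assms] in \<open>auto intro!: graph_term_nth_eq_0\<close>)
  finally show "graph_series G $ m = fps_sum (graph_term G) (pverts G \<rightarrow>\<^sub>E UNIV) $ m" .
qed

text \<open>The condition on E says that each edge is listed in one orientation only and that there
  are no loops. The quadratic form then counts every edge twice, and halving is exact.\<close>

lemma graph_exponent_edge_graph:
  assumes "finite V" "E \<subseteq> V \<times> V" "E \<inter> E\<inverse> = {}"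
  shows "graph_exponent (edge_graph V E) n = (\<Sum>(i, j)\<in>E. n i * n j) + (\<Sum>i\<in>V. n i)"
proof -
  have fin: "finite E"
    using assms(1,2) by (meson finite_SigmaI finite_subset)
  have "adj_form (edge_graph V E) n =
        (\<Sum>p\<in>V \<times> V. if p \<in> E \<union> E\<inverse> then n (fst p) * n (snd p) else 0)"
    unfolding adj_form_def sum.cartesian_product
    by (intro sum.cong) (auto simp: edge_graph_def adj_matrix_def)
  also have "\<dots> = (\<Sum>p\<in>(V \<times> V) \<inter> (E \<union> E\<inverse>). n (fst p) * n (snd p))"
    using assms(1) by (intro sum.inter_restrict[symmetric]) auto
  also have "(V \<times> V) \<inter> (E \<union> E\<inverse>) = E \<union> E\<inverse>"
    using assms(2) by auto
  also have "(\<Sum>p\<in>E \<union> E\<inverse>. n (fst p) * n (snd p)) =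
             (\<Sum>p\<in>E. n (fst p) * n (snd p)) + (\<Sum>p\<in>E\<inverse>. n (fst p) * n (snd p))"
    using assms(3) fin by (intro sum.union_disjoint) auto
  also have "(\<Sum>p\<in>E\<inverse>. n (fst p) * n (snd p)) = (\<Sum>p\<in>E. n (fst p) * n (snd p))"
    by (rule sum.reindex_bij_witness[of _ prod.swap prod.swap]) (auto simp: mult.commute)
  finally show ?thesis
    by (simp add: graph_exponent_def edge_graph_def case_prod_unfold)
qed

section \<open>Disjoint unions and relabellings\<close>

lemma bij_betw_PiE_Plus:
  "bij_betw (\<lambda>(x, y). case_sum x y) (PiE A (\<lambda>_. B) \<times> PiE C (\<lambda>_. B)) (PiE (A <+> C) (\<lambda>_. B))"
proof (rule bij_betwI[where g = "\<lambda>n. (n \<circ> Inl, n \<circ> Inr)"])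
  show "(\<lambda>(x, y). case_sum x y) \<in> PiE A (\<lambda>_. B) \<times> PiE C (\<lambda>_. B) \<rightarrow> PiE (A <+> C) (\<lambda>_. B)"
  proof
    fix p assume "p \<in> PiE A (\<lambda>_. B) \<times> PiE C (\<lambda>_. B)"
    then obtain x y where p: "p = (x, y)" "x \<in> PiE A (\<lambda>_. B)" "y \<in> PiE C (\<lambda>_. B)"
      by auto
    show "(case p of (x, y) \<Rightarrow> case_sum x y) \<in> PiE (A <+> C) (\<lambda>_. B)"
    proof (rule PiE_I)
      fix i assume "i \<in> A <+> C"
      thus "(case p of (x, y) \<Rightarrow> case_sum x y) i \<in> B"
        using p by (cases i) (auto dest: PiE_mem)
    next
      fix i assume "i \<notin> A <+> C"
      thus "(case p of (x, y) \<Rightarrow> case_sum x y) i = undefined"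
        using p by (cases i) (auto dest: PiE_arb)
    qed
  qed
  show "(\<lambda>n. (n \<circ> Inl, n \<circ> Inr)) \<in> PiE (A <+> C) (\<lambda>_. B) \<rightarrow> PiE A (\<lambda>_. B) \<times> PiE C (\<lambda>_. B)"
  proof
    fix n assume n: "n \<in> PiE (A <+> C) (\<lambda>_. B)"
    have "n \<circ> Inl \<in> PiE A (\<lambda>_. B)"
      by (rule PiE_I) (use PiE_mem[OF n] PiE_arb[OF n] in auto)
    moreover have "n \<circ> Inr \<in> PiE C (\<lambda>_. B)"
      by (rule PiE_I) (use PiE_mem[OF n] PiE_arb[OF n] in auto)
    ultimately show "(n \<circ> Inl, n \<circ> Inr) \<in> PiE A (\<lambda>_. B) \<times> PiE C (\<lambda>_. B)"
      by simp
  qed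
qed (auto simp: fun_eq_iff split: sum.splits)

text \<open>The truncating division by 2 is additive here because both forms are even.\<close>

lemma graph_exponent_disjoint_union:
  assumes "pair_graph G" "pair_graph H"
  shows "graph_exponent (G \<oplus> H) (case_sum x y) = graph_exponent G x + graph_exponent H y"
proof -
  interpret G: pair_graph G by fact
  interpret H: pair_graph H by fact
  have "adj_matrix (G \<oplus> H) (Inl i) (Inl j) = adj_matrix G i j"
       "adj_matrix (G \<oplus> H) (Inr k) (Inr l) = adj_matrix H k l"
       "adj_matrix (G \<oplus> H) (Inl i) (Inr l) = 0"
       "adj_matrix (G \<oplus> H) (Inr k) (Inl j) = 0" for i j k l
    by (auto simp: adj_matrix_def disjoint_union_def)
  moreover have "pverts (G \<oplus> H) = pverts G <+> pverts H"
    by (simp add: disjoint_union_def)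
  ultimately show ?thesis
    using even_adj_form[OF assms(1), of x] even_adj_form[OF assms(2), of y]
    by (simp add: graph_exponent_def adj_form_def sum.Plus G.pair_finite_verts H.pair_finite_verts)
qed

lemma graph_series_disjoint_union:
  assumes "pair_graph G" "pair_graph H"
  shows "graph_series (G \<oplus> H) = graph_series G * graph_series H"
proof -
  interpret G: pair_graph G by fact
  interpret H: pair_graph H by fact
  have verts: "pverts (G \<oplus> H) = pverts G <+> pverts H"
    by (simp add: disjoint_union_def)
  have "graph_term (G \<oplus> H) (case_sum x y) = graph_term G x * graph_term H y" for x y
    unfolding graph_term_eq graph_exponent_disjoint_union[OF assms] verts
    by (simp add: prod.Plus G.pair_finite_verts H.pair_finite_verts power_add mult_ac)
  hence "(\<lambda>p. graph_term (G \<oplus> H) (case p of (x, y) \<Rightarrow> case_sum x y)) =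
         (\<lambda>(x, y). graph_term G x * graph_term H y)"
    by (simp add: fun_eq_iff)
  hence "graph_series (G \<oplus> H) = fps_sum (\<lambda>(x, y). graph_term G x * graph_term H y)
           ((pverts G \<rightarrow>\<^sub>E UNIV) \<times> (pverts H \<rightarrow>\<^sub>E UNIV))"
    using fps_sum_reindex[OF bij_betw_PiE_Plus, of "graph_term (G \<oplus> H)" "pverts G" UNIV "pverts H"]
    by (subst graph_series_eq) (simp_all add: verts G.pair_finite_verts H.pair_finite_verts)
  thus ?thesis
    by (simp add: fps_sum_times graph_series_eq graph_term_summable' G.pair_finite_verts H.pair_finite_verts)
qed

lemma graph_series_pt: "graph_series pt = euler_series"
proof -
  have "graph_term pt = (\<lambda>n. fps_X ^ n () * inverse (qpoch (n ())))"
    by (simp add: fun_eq_iff graph_term_eq graph_exponent_def adj_form_def adj_matrix_def pt_def)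
  thus ?thesis
    by (simp add: graph_series_eq pt_def fps_sum_PiE_singleton euler_series_def)
qed

lemma bij_betw_PiE_comp:
  assumes "bij_betw f I J"
  shows "bij_betw (\<lambda>n. restrict (n \<circ> f) I) (PiE J (\<lambda>_. A)) (PiE I (\<lambda>_. A))"
proof (rule bij_betwI[where g = "\<lambda>n. restrict (n \<circ> inv_into I f) J"])
  have f: "f i \<in> J" "inv_into I f (f i) = i" if "i \<in> I" for i
    using assms that by (auto simp: bij_betw_def)
  have g: "inv_into I f j \<in> I" "f (inv_into I f j) = j" if "j \<in> J" for j
    using assms that by (auto simp: bij_betw_def inv_into_into f_inv_into_f)
  show "(\<lambda>n. restrict (n \<circ> f) I) \<in> PiE J (\<lambda>_. A) \<rightarrow> PiE I (\<lambda>_. A)"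
    using f(1) by (auto simp: PiE_iff)
  show "(\<lambda>n. restrict (n \<circ> inv_into I f) J) \<in> PiE I (\<lambda>_. A) \<rightarrow> PiE J (\<lambda>_. A)"
    using g(1) by (auto simp: PiE_iff)
  show "restrict (restrict (n \<circ> f) I \<circ> inv_into I f) J = n" if "n \<in> PiE J (\<lambda>_. A)" for n
    using that g by (auto simp: PiE_iff extensional_def fun_eq_iff)
  show "restrict (restrict (n \<circ> inv_into I f) J \<circ> f) I = n" if "n \<in> PiE I (\<lambda>_. A)" for n
    using that f by (auto simp: PiE_iff extensional_def fun_eq_iff)
qed

text \<open>The second hypothesis makes \<open>F\<close> blind to arguments outside I, where a
  composed assignment need not be extensional.\<close>

lemma fps_sum_PiE_image:
  assumes "inj_on f I" "\<And>x y. (\<And>i. i \<in> I \<Longrightarrow> x i = y i) \<Longrightarrow> F x = F y"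
  shows "fps_sum (\<lambda>n. F (\<lambda>i. n (f i))) (PiE (f ` I) (\<lambda>_. A)) = fps_sum F (PiE I (\<lambda>_. A))"
proof -
  have "F (restrict (n \<circ> f) I) = F (\<lambda>i. n (f i))" for n
    by (rule assms(2)) simp
  thus ?thesis
    using fps_sum_reindex[OF bij_betw_PiE_comp[OF inj_on_imp_bij_betw[OF assms(1)]], of F A] by simp
qed

lemma graph_series_iso:
  assumes "finite (pverts G)" "parcs G \<subseteq> pverts G \<times> pverts G" "inj_on f (pverts G)"
    and "pverts H = f ` pverts G" "parcs H = map_prod f f ` parcs G"
  shows "graph_series H = graph_series G"
proof -
  have arcs: "(f i, f j) \<in> parcs H \<longleftrightarrow> (i, j) \<in> parcs G" if "i \<in> pverts G" "j \<in> pverts G" for i j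
  proof
    assume "(f i, f j) \<in> parcs H"
    then obtain i' j' where ij: "(i', j') \<in> parcs G" "f i' = f i" "f j' = f j"
      using assms(5) by auto
    hence "i' = i" "j' = j"
      using assms(2,3) that by (auto simp: inj_on_def)
    thus "(i, j) \<in> parcs G" using ij by simp
  qed (use assms(5) in \<open>auto simp: image_iff intro: bexI[of _ "(i, j)"]\<close>)
  have "graph_term H n = graph_term G (\<lambda>i. n (f i))" for n
    using assms(3,4) by (simp add: graph_term_eq graph_exponent_def adj_form_def adj_matrix_def
        sum.reindex prod.reindex arcs cong: sum.cong)
  hence "graph_term H = (\<lambda>n. graph_term G (\<lambda>i. n (f i)))" ..
  hence "graph_series H = fps_sum (\<lambda>n. graph_term G (\<lambda>i. n (f i))) (f ` pverts G \<rightarrow>\<^sub>E UNIV)"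
    using assms(1,4) by (simp add: graph_series_eq)
  also have "\<dots> = fps_sum (graph_term G) (pverts G \<rightarrow>\<^sub>E UNIV)"
    by (rule fps_sum_PiE_image[OF assms(3)])
       (simp add: graph_term_eq graph_exponent_def adj_form_def cong: sum.cong prod.cong)
  finally show ?thesis
    using assms(1) by (simp add: graph_series_eq)
qed

text \<open>An isomorphism of digraphs also carries maps for arcs, heads and tails. Where arcs are
  pairs of vertices, the vertex map f provides them: \<open>map_prod f f\<close> and the two
  projections.\<close>

lemma digraph_iso_with_projI:
  assumes "pair_wf_digraph G" "inj_on f (pverts G)"
    and "pverts H = f ` pverts G" "parcs H = map_prod f f ` parcs G"
  shows "digraph_iso (with_proj G) (with_proj H)"
proof -
  interpret pair_wf_digraph G by fact
  define h where "h = \<lparr>iso_verts = f, iso_arcs = map_prod f f, iso_head = snd, iso_tail = fst\<rparr>"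
  have "inj_on (map_prod f f) (parcs G)"
    using assms(2) in_arcsD1 in_arcsD2 by (auto simp: inj_on_def)
  hence "pre_digraph.digraph_isomorphism (with_proj G) h"
    using assms(2) wf_digraph_axioms
    by (simp add: pre_digraph.digraph_isomorphism_def h_def)
  moreover have "with_proj H = app_iso h (with_proj G)"
    by (simp add: app_iso_def with_proj_def h_def assms)
  ultimately show ?thesis
    unfolding digraph_iso_def by blast
qed

text \<open>Summing out an independent set \<open>J\<close> of vertices; \<open>b x j\<close> is the sum of \<open>x\<close> over the
  neighbours of \<open>j\<close>.\<close>

lemma fps_sum_independent:
  assumes "finite I" "finite J" "I \<inter> J = {}"
    and "\<And>n. (\<Sum>i\<in>I \<union> J. n i) \<le> e n"
    and "\<And>n. e n = a n + (\<Sum>j\<in>J. n j * (b n j + 1))"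
    and "\<And>n n'. (\<And>i. i \<in> I \<Longrightarrow> n i = n' i) \<Longrightarrow> a n = a n'"
    and "\<And>n n' j. (\<And>i. i \<in> I \<Longrightarrow> n i = n' i) \<Longrightarrow> j \<in> J \<Longrightarrow> b n j = b n' j"
  shows "fps_sum (\<lambda>n. fps_X ^ e n * (\<Prod>i\<in>I \<union> J. inverse (qpoch (n i)))) (I \<union> J \<rightarrow>\<^sub>E UNIV) =
    euler_series ^ card J *
      fps_sum (\<lambda>x. fps_X ^ a x * (\<Prod>i\<in>I. inverse (qpoch (x i))) * (\<Prod>j\<in>J. qpoch (b x j))) (I \<rightarrow>\<^sub>E UNIV)"
proof -
  \<comment> \<open>Assignments x of I and y of J are glued. As J is independent, y enters linearly,
    with slope b x j + 1 in y j.\<close>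
  have e: "e (\<lambda>i. if i \<in> I then x i else y i) = a x + (\<Sum>j\<in>J. y j * (b x j + 1))" for x y
  proof -
    have "a (\<lambda>i. if i \<in> I then x i else y i) = a x"
      by (rule assms(6)) simp
    moreover have "(if j \<in> I then x j else y j) * (b (\<lambda>i. if i \<in> I then x i else y i) j + 1) = y j * (b x j + 1)"
      if "j \<in> J" for j
      using assms(3) that assms(7)[of "\<lambda>i. if i \<in> I then x i else y i" x j] by auto
    ultimately show ?thesis
      unfolding assms(5) by (simp only: cong: sum.cong)
  qed
  define f where "f n = fps_X ^ e n * (\<Prod>i\<in>I \<union> J. inverse (qpoch (n i)))" for n
  define g where "g x = fps_X ^ a x * (\<Prod>i\<in>I. inverse (qpoch (x i)))" for x
  have s: "fps_summable f (I \<union> J \<rightarrow>\<^sub>E UNIV)"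
    unfolding f_def by (rule fps_summable_PiE_X_power) (use assms(1,2,4) in simp_all)
  have sj: "fps_summable (\<lambda>n. fps_X ^ (n * (l + 1)) * inverse (qpoch n)) UNIV" for l
    by (rule fps_summable_nat_X_power) simp
  have f: "f (\<lambda>i. if i \<in> I then x i else y i) =
           g x * (\<Prod>j\<in>J. fps_X ^ (y j * (b x j + 1)) * inverse (qpoch (y j)))" for x y
  proof -
    have "(\<Prod>i\<in>I. inverse (qpoch (if i \<in> I then x i else y i))) = (\<Prod>i\<in>I. inverse (qpoch (x i)))"
      by (intro prod.cong) auto
    moreover have "(\<Prod>i\<in>J. inverse (qpoch (if i \<in> I then x i else y i))) = (\<Prod>i\<in>J. inverse (qpoch (y i)))"
      using assms(3) by (intro prod.cong) auto
    ultimately show ?thesis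
      unfolding f_def g_def e prod.union_disjoint[OF assms(1-3)]
      by (simp only: power_add power_sum prod.distrib mult_ac)
  qed
  \<comment> \<open>For fixed x the sum over y is a product over J, and each factor is Euler's
    identity with N = b x j.\<close>
  have "fps_sum (\<lambda>y. f (\<lambda>i. if i \<in> I then x i else y i)) (J \<rightarrow>\<^sub>E UNIV) =
        euler_series ^ card J * (g x * (\<Prod>j\<in>J. qpoch (b x j)))" for x
  proof -
    have "fps_sum (\<lambda>y. f (\<lambda>i. if i \<in> I then x i else y i)) (J \<rightarrow>\<^sub>E UNIV) =
          g x * (\<Prod>j\<in>J. qpoch (b x j) * euler_series)"
      unfolding f by (subst fps_sum_mult_left, rule fps_summable_prod_PiE[OF assms(2) sj],
          subst fps_sum_prod_PiE[OF assms(2) sj], simp only: fps_sum_euler)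
    thus ?thesis by (simp add: prod.distrib mult_ac)
  qed
  hence "fps_sum f (I \<union> J \<rightarrow>\<^sub>E UNIV) =
         fps_sum (\<lambda>x. euler_series ^ card J * (g x * (\<Prod>j\<in>J. qpoch (b x j)))) (I \<rightarrow>\<^sub>E UNIV)"
    unfolding fps_sum_PiE_Un[OF assms(3) s] by simp
  also have "\<dots> = euler_series ^ card J * fps_sum (\<lambda>x. g x * (\<Prod>j\<in>J. qpoch (b x j))) (I \<rightarrow>\<^sub>E UNIV)"
  proof (rule fps_sum_mult_left)
    \<comment> \<open>Setting all variables in J to 0 turns the lower bound for e into one for
      a.\<close>
    have "(\<Sum>i\<in>I. x i) \<le> a x" for x
      using assms(4)[of "\<lambda>i. if i \<in> I then x i else 0"] e[of x "\<lambda>_. 0"] assms(1-3)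
      by (simp add: sum.union_disjoint)
    hence "fps_summable (\<lambda>x. fps_X ^ a x * ((\<Prod>i\<in>I. inverse (qpoch (x i))) * (\<Prod>j\<in>J. qpoch (b x j)))) (I \<rightarrow>\<^sub>E UNIV)"
      by (intro fps_summable_PiE_X_power assms)
    thus "fps_summable (\<lambda>x. g x * (\<Prod>j\<in>J. qpoch (b x j))) (I \<rightarrow>\<^sub>E UNIV)"
      by (simp add: g_def mult_ac)
  qed
  finally show ?thesis
    unfolding f_def g_def .
qed

text \<open>The leaves are the ends 2j+1 of the legs and the vertex 2k+2. Their neighbours, the
  vertices 2j and the centre 1, occur exactly once each, so the factors (q)_n from Euler's identity
  cancel every remaining denominator and the middle variables run over geometric series.\<close>

lemma graph_series_T_graph: "graph_series (T_graph k) = euler_series ^ (k + 1) * star_series k"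
proof -
  define M where "M = (\<lambda>j. 2 * j) ` {1..k}"
  define L where "L = (\<lambda>j. 2 * j + 1) ` {1..k}"
  define E where "E = (\<lambda>j. (1, 2 * j)) ` {1..k} \<union> (\<lambda>j. (2 * j, 2 * j + 1)) ` {1..k} \<union> {(1, 2 * k + 2)}"
  define V where "V = {1} \<union> M \<union> insert (2 * k + 2) L"
  define a where "a n = n 1 + (\<Sum>j=1..k. n (2 * j) * (n 1 + 1))" for n :: "nat \<Rightarrow> nat"
  define b where "b n i = (if i = 2 * k + 2 then n 1 else n (i - 1))" for n :: "nat \<Rightarrow> nat" and i
  have fin: "finite M" "finite L"
    by (simp_all add: M_def L_def)
  have M: "even i \<and> i \<le> 2 * k" if "i \<in> M" for i
    using that by (auto simp: M_def)
  have L: "odd i \<and> i > 1" if "i \<in> L" for i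
    using that by (auto simp: L_def)
  have disj: "1 \<notin> M" "1 \<notin> L" "2 * k + 2 \<notin> M" "2 * k + 2 \<notin> L" "M \<inter> L = {}"
    using M[of 1] L[of 1] M[of "2 * k + 2"] L[of "2 * k + 2"] M L by force+
  have inj: "inj_on (\<lambda>j. 2 * j) A" "inj_on (\<lambda>j. 2 * j + 1) A" for A :: "nat set"
    by (auto simp: inj_on_def)
  have V: "{1..2 * k + 2} = V"
  proof (intro equalityI subsetI)
    fix i assume i: "i \<in> {1..2 * k + 2}"
    show "i \<in> V"
    proof (cases "even i")
      case True
      then obtain j where "i = 2 * j" by (elim evenE)
      with i show ?thesis by (cases "j = k + 1") (auto simp: V_def M_def)
    next
      case False
      then obtain j where "i = 2 * j + 1" by (elim oddE)
      with i show ?thesis by (cases "j = 0") (auto simp: V_def L_def)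
    qed
  qed (auto simp: V_def M_def L_def)
  have T: "T_graph k = edge_graph V E"
    unfolding T_graph_def V by (intro arg_cong[of _ _ "edge_graph V"]) (auto simp: E_def)
  have EV: "E \<subseteq> V \<times> V"
    by (auto simp: E_def V_def M_def L_def)
  \<comment> \<open>All pairs in E are listed with the smaller vertex first.\<close>
  have anti: "E \<inter> E\<inverse> = {}"
  proof -
    have "i < j" if "(i, j) \<in> E" for i j
      using that by (auto simp: E_def)
    thus ?thesis using less_asym by blast
  qed
  have sumE: "(\<Sum>(i, j)\<in>E. n i * n j) =
        (\<Sum>j=1..k. n 1 * n (2 * j)) + (\<Sum>j=1..k. n (2 * j) * n (2 * j + 1)) + n 1 * n (2 * k + 2)"
    for n :: "nat \<Rightarrow> nat"
  proof -
    define A B where "A = (\<lambda>j. (1 :: nat, 2 * j)) ` {1..k}" and "B = (\<lambda>j. (2 * j, 2 * j + 1)) ` {1..k}"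
    have A: "fst p = 1 \<and> snd p \<le> 2 * k" if "p \<in> A" for p
      using that by (auto simp: A_def)
    have B: "even (fst p)" if "p \<in> B" for p
      using that by (auto simp: B_def)
    have fin_AB: "finite A" "finite B"
      by (simp_all add: A_def B_def)
    have inj_AB: "inj_on (\<lambda>j. (1 :: nat, 2 * j)) {1..k}" "inj_on (\<lambda>j. (2 * j, 2 * j + 1)) {1..k}"
      by (simp_all add: inj_on_def)
    have "(1, 2 * k + 2) \<notin> A \<union> B"
      using A[of "(1, 2 * k + 2)"] B[of "(1, 2 * k + 2)"] by auto
    hence "(\<Sum>(i, j)\<in>E. n i * n j) = (\<Sum>(i, j)\<in>A \<union> B. n i * n j) + n 1 * n (2 * k + 2)"
      unfolding E_def A_def[symmetric] B_def[symmetric] using fin_AB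
      by (subst sum.union_disjoint) simp_all
    also have "A \<inter> B = {}"
    proof (rule equals0I)
      fix p assume "p \<in> A \<inter> B"
      with A[of p] B[of p] show False by simp
    qed
    hence "(\<Sum>(i, j)\<in>A \<union> B. n i * n j) = (\<Sum>(i, j)\<in>A. n i * n j) + (\<Sum>(i, j)\<in>B. n i * n j)"
      by (rule sum.union_disjoint[OF fin_AB])
    also have "(\<Sum>(i, j)\<in>A. n i * n j) = (\<Sum>j=1..k. n 1 * n (2 * j))"
      unfolding A_def by (subst sum.reindex[OF inj_AB(1)]) simp
    also have "(\<Sum>(i, j)\<in>B. n i * n j) = (\<Sum>j=1..k. n (2 * j) * n (2 * j + 1))"
      unfolding B_def by (subst sum.reindex[OF inj_AB(2)]) simp
    finally show ?thesis .
  qed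
  have sumV: "(\<Sum>i\<in>V. n i) = n 1 + (\<Sum>j=1..k. n (2 * j)) + (n (2 * k + 2) + (\<Sum>j=1..k. n (2 * j + 1)))"
    for n :: "nat \<Rightarrow> nat"
  proof -
    have "(\<Sum>i\<in>V. n i) = (\<Sum>i\<in>{1} \<union> M. n i) + (\<Sum>i\<in>insert (2 * k + 2) L. n i)"
      unfolding V_def by (rule sum.union_disjoint) (use fin disj in auto)
    moreover have "(\<Sum>i\<in>M. n i) = (\<Sum>j=1..k. n (2 * j))"
      unfolding M_def by (subst sum.reindex[OF inj(1)]) simp
    moreover have "(\<Sum>i\<in>L. n i) = (\<Sum>j=1..k. n (2 * j + 1))"
      unfolding L_def by (subst sum.reindex[OF inj(2)]) simp
    ultimately show ?thesis
      using fin disj by simp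
  qed
  have exponent: "graph_exponent (T_graph k) n = a n + (\<Sum>i\<in>insert (2 * k + 2) L. n i * (b n i + 1))" for n
  proof -
    have "(\<Sum>i\<in>L. n i * (b n i + 1)) = (\<Sum>j=1..k. n (2 * j + 1) * (n (2 * j) + 1))"
      unfolding L_def by (subst sum.reindex[OF inj(2)]) (auto simp: b_def intro!: sum.cong)
    hence "(\<Sum>i\<in>insert (2 * k + 2) L. n i * (b n i + 1)) =
           n (2 * k + 2) * (n 1 + 1) + (\<Sum>j=1..k. n (2 * j + 1) * (n (2 * j) + 1))"
      using fin disj by (simp add: b_def)
    moreover have "graph_exponent (T_graph k) n = (\<Sum>(i, j)\<in>E. n i * n j) + (\<Sum>i\<in>V. n i)"
      unfolding T using fin EV anti by (intro graph_exponent_edge_graph) (simp_all add: V_def)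
    ultimately show ?thesis
      unfolding sumE sumV a_def
      by (simp add: algebra_simps sum.distrib sum_distrib_left)
  qed
  have "graph_series (T_graph k) = fps_sum (\<lambda>n. fps_X ^ graph_exponent (T_graph k) n *
          (\<Prod>i\<in>V. inverse (qpoch (n i)))) (V \<rightarrow>\<^sub>E UNIV)"
    using fin by (subst graph_series_eq) (simp_all add: graph_term_eq[abs_def] T edge_graph_def V_def)
  also have "\<dots> = euler_series ^ card (insert (2 * k + 2) L) *
      fps_sum (\<lambda>x. fps_X ^ a x * (\<Prod>i\<in>{1} \<union> M. inverse (qpoch (x i))) *
        (\<Prod>j\<in>insert (2 * k + 2) L. qpoch (b x j))) ({1} \<union> M \<rightarrow>\<^sub>E UNIV)"
    unfolding V_def
  proof (rule fps_sum_independent)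
    show "(\<Sum>i\<in>{1} \<union> M \<union> insert (2 * k + 2) L. n i) \<le> graph_exponent (T_graph k) n" for n
    proof -
      have "pverts (T_graph k) = {1} \<union> M \<union> insert (2 * k + 2) L"
        by (simp add: T edge_graph_def V_def)
      thus ?thesis
        unfolding graph_exponent_def by (simp only: le_add2)
    qed
    show "a n = a n'" if "\<And>i. i \<in> {1} \<union> M \<Longrightarrow> n i = n' i" for n n'
    proof -
      have "n 1 = n' 1" "\<And>j. j \<in> {1..k} \<Longrightarrow> n (2 * j) = n' (2 * j)"
        using that by (auto simp: M_def)
      thus ?thesis by (simp add: a_def)
    qed
    show "b n j = b n' j" if "\<And>i. i \<in> {1} \<union> M \<Longrightarrow> n i = n' i" "j \<in> insert (2 * k + 2) L" for n n' j
    proof (cases "j = 2 * k + 2")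
      case True
      thus ?thesis using that(1)[of 1] by (simp add: b_def)
    next
      case False
      with that(2) have "j - 1 \<in> {1} \<union> M"
        by (auto simp: L_def M_def)
      thus ?thesis using False that(1)[of "j - 1"] by (simp add: b_def)
    qed
  qed (use fin disj exponent in auto)
  also have "card (insert (2 * k + 2) L) = k + 1"
  proof -
    have "card L = k"
      unfolding L_def by (subst card_image[OF inj(2)]) simp
    thus ?thesis using fin disj by simp
  qed
  also have "(\<lambda>x. fps_X ^ a x * (\<Prod>i\<in>{1} \<union> M. inverse (qpoch (x i))) *
        (\<Prod>j\<in>insert (2 * k + 2) L. qpoch (b x j))) =
      (\<lambda>x. fps_X ^ x 1 * (\<Prod>i\<in>M. fps_X ^ (x i * (x 1 + 1))))"
  proof
    fix x :: "nat \<Rightarrow> nat"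
    have "(\<Prod>j\<in>L. qpoch (b x j)) = (\<Prod>j=1..k. qpoch (x (2 * j)))"
      unfolding L_def by (subst prod.reindex[OF inj(2)]) (auto simp: b_def intro!: prod.cong)
    also have "\<dots> = (\<Prod>i\<in>M. qpoch (x i))"
      unfolding M_def by (subst prod.reindex[OF inj(1)]) simp
    finally have L: "(\<Prod>j\<in>insert (2 * k + 2) L. qpoch (b x j)) = qpoch (x 1) * (\<Prod>i\<in>M. qpoch (x i))"
      using fin disj by (simp add: b_def)
    have I: "(\<Prod>i\<in>{1} \<union> M. inverse (qpoch (x i))) = inverse (qpoch (x 1)) * (\<Prod>i\<in>M. inverse (qpoch (x i)))"
      using fin disj by simp
    have "(\<Prod>i\<in>M. qpoch (x i)) * (\<Prod>i\<in>M. inverse (qpoch (x i))) = 1"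
      by (simp flip: prod.distrib)
    hence "(\<Prod>i\<in>{1} \<union> M. inverse (qpoch (x i))) * (\<Prod>j\<in>insert (2 * k + 2) L. qpoch (b x j)) =
           qpoch (x 1) * inverse (qpoch (x 1))"
      unfolding L I by (metis (no_types, lifting) mult.assoc mult.left_commute mult.right_neutral mult.commute)
    moreover have "(\<Sum>j=1..k. x (2 * j) * (x 1 + 1)) = (\<Sum>i\<in>M. x i * (x 1 + 1))"
      unfolding M_def by (subst sum.reindex[OF inj(1)]) simp
    ultimately show "fps_X ^ a x * (\<Prod>i\<in>{1} \<union> M. inverse (qpoch (x i))) *
        (\<Prod>j\<in>insert (2 * k + 2) L. qpoch (b x j)) = fps_X ^ x 1 * (\<Prod>i\<in>M. fps_X ^ (x i * (x 1 + 1)))"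
      unfolding a_def by (simp only: mult.assoc power_add power_sum qpoch_inverse mult_1_right)
  qed
  also have "fps_sum (\<lambda>x. fps_X ^ x 1 * (\<Prod>i\<in>M. fps_X ^ (x i * (x 1 + 1)))) ({1} \<union> M \<rightarrow>\<^sub>E UNIV) = star_series k"
  proof -
    define f where "f x = fps_X ^ x 1 * (\<Prod>i\<in>M. fps_X ^ (x i * (x 1 + 1)) :: rat fps)" for x :: "nat \<Rightarrow> nat"
    have "fps_summable (\<lambda>x. fps_X ^ (x 1 + (\<Sum>i\<in>M. x i * (x 1 + 1))) * (1 :: rat fps)) ({1} \<union> M \<rightarrow>\<^sub>E UNIV)"
      by (rule fps_summable_PiE_X_power) (use fin disj in \<open>auto intro: sum_mono\<close>)
    hence s: "fps_summable f ({1} \<union> M \<rightarrow>\<^sub>E UNIV)"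
      by (simp add: f_def power_add power_sum cong: fps_summable_cong)
    \<comment> \<open>With the centre fixed at x 1, the k middle variables are independent, and each
      contributes the same geometric series of ratio q^(x 1 + 1).\<close>
    have inner: "fps_sum (\<lambda>y. f (\<lambda>i. if i \<in> {1} then x i else y i)) (M \<rightarrow>\<^sub>E UNIV) =
          fps_X ^ x 1 * inverse (1 - fps_X ^ Suc (x 1)) ^ k" for x
    proof -
      have "(\<Prod>i\<in>M. fps_X ^ ((if i \<in> {1} then x i else y i) * (x 1 + 1)) :: rat fps) =
            (\<Prod>i\<in>M. fps_X ^ (y i * Suc (x 1)))" for y
        using disj by (intro prod.cong) auto
      hence f: "f (\<lambda>i. if i \<in> {1} then x i else y i) = fps_X ^ x 1 * (\<Prod>i\<in>M. fps_X ^ (y i * Suc (x 1)))" for y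
        by (simp add: f_def)
      have si: "fps_summable (\<lambda>n. fps_X ^ (n * Suc (x 1)) :: rat fps) UNIV"
        using fps_summable_nat_X_power[of "\<lambda>n. n * Suc (x 1)" "\<lambda>_. 1"] by simp
      have cM: "card M = k"
        unfolding M_def by (subst card_image[OF inj(1)]) simp
      show ?thesis
        unfolding f fps_sum_mult_left[OF fps_summable_prod_PiE[OF fin(1) si]]
          fps_sum_prod_PiE[OF fin(1) si] fps_sum_geometric prod_constant cM ..
    qed
    show ?thesis
      unfolding f_def[symmetric]
      using fps_sum_PiE_Un[OF _ s] disj
      by (simp only: inner) (simp add: fps_sum_PiE_singleton star_series_def del: power_Suc)
  qed
  finally show ?thesis .
qed

text \<open>Here c s is the step S_s - S_(s+1), with S_k = j. The step of largest index is taken as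
  the outer sum: it enters every S_s with s < k, so fixing it amounts to raising j, in agreement
  with the recursion of \<open>chain\<close>.\<close>

lemma fps_sum_chain_PiE_lessThan:
  "fps_sum (\<lambda>c. fps_X ^ (j + (\<Sum>s<k. c s)) *
      (\<Prod>s<k. inverse (1 - fps_X ^ Suc (j + (\<Sum>i=s..<k. c i))))) ({..<k} \<rightarrow>\<^sub>E UNIV) = chain k j"
proof (induction k arbitrary: j)
  case 0
  show ?case by (simp add: fps_sum_finite)
next
  case (Suc k)
  define P :: "nat \<Rightarrow> nat \<Rightarrow> (nat \<Rightarrow> nat) \<Rightarrow> rat fps"
    where "P k j c = fps_X ^ (j + (\<Sum>s<k. c s)) *
      (\<Prod>s<k. inverse (1 - fps_X ^ Suc (j + (\<Sum>i=s..<k. c i))))" for k j c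
  have s: "fps_summable (P l j) ({..<l} \<rightarrow>\<^sub>E UNIV)" for l j
    unfolding P_def by (rule fps_summable_PiE_X_power) simp_all
  have IH: "fps_sum (P k j) ({..<k} \<rightarrow>\<^sub>E UNIV) = chain k j" for j
    unfolding P_def by (rule Suc.IH)
  have Un: "{..<Suc k} = {k} \<union> {..<k}"
    by auto
  have "P (Suc k) j (\<lambda>i. if i \<in> {k} then x i else y i) =
        inverse (1 - fps_X ^ Suc (j + x k)) * P k (j + x k) y" for x y
  proof -
    have "(\<Sum>i=s..<Suc k. if i \<in> {k} then x i else y i) = x k + (\<Sum>i=s..<k. y i)" if "s \<le> k" for s
      using that by simp
    moreover have "(\<Sum>s<Suc k. if s \<in> {k} then x s else y s) = x k + (\<Sum>s<k. y s)"
      by simp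
    ultimately show ?thesis
      unfolding P_def by (simp add: add.assoc mult_ac del: power_Suc sum.op_ivl_Suc)
  qed
  hence inner: "fps_sum (\<lambda>y. P (Suc k) j (\<lambda>i. if i \<in> {k} then x i else y i)) ({..<k} \<rightarrow>\<^sub>E UNIV) =
        inverse (1 - fps_X ^ Suc (j + x k)) * chain k (j + x k)" for x
    by (simp only: fps_sum_mult_left[OF s] IH)
  have "fps_sum (P (Suc k) j) ({..<Suc k} \<rightarrow>\<^sub>E UNIV) =
        fps_sum (\<lambda>x. inverse (1 - fps_X ^ Suc (j + x k)) * chain k (j + x k)) ({k} \<rightarrow>\<^sub>E UNIV)"
    unfolding Un by (subst fps_sum_PiE_Un) (use s[of "Suc k" j] in \<open>simp_all only: Un inner\<close>, auto)
  also have "\<dots> = chain (Suc k) j"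
    by (subst fps_sum_PiE_singleton) simp_all
  finally show ?case
    unfolding P_def .
qed

text \<open>The last variable c k is S_k itself and takes the role of j.\<close>

lemma fps_sum_chain_PiE_atMost:
  "fps_sum (\<lambda>c. fps_X ^ (\<Sum>s\<le>k. c s) *
      (\<Prod>s<k. inverse (1 - fps_X ^ Suc (\<Sum>i=s..k. c i)))) ({..k} \<rightarrow>\<^sub>E UNIV) = fps_sum (chain k) UNIV"
proof -
  define F :: "(nat \<Rightarrow> nat) \<Rightarrow> rat fps" where "F c = fps_X ^ (\<Sum>s\<le>k. c s) *
      (\<Prod>s<k. inverse (1 - fps_X ^ Suc (\<Sum>i=s..k. c i)))" for c
  have Un: "{..k} = {k} \<union> {..<k}"
    by auto
  have "fps_summable F ({..k} \<rightarrow>\<^sub>E UNIV)"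
    unfolding F_def by (rule fps_summable_PiE_X_power) simp_all
  hence s: "fps_summable F ({k} \<union> {..<k} \<rightarrow>\<^sub>E UNIV)"
    unfolding Un .
  have F: "F (\<lambda>i. if i \<in> {k} then x i else y i) = fps_X ^ (x k + (\<Sum>s<k. y s)) *
        (\<Prod>s<k. inverse (1 - fps_X ^ Suc (x k + (\<Sum>i=s..<k. y i))))" for x y
  proof -
    have "(\<Sum>i=s..k. if i \<in> {k} then x i else y i) = x k + (\<Sum>i=s..<k. y i)" if "s \<le> k" for s
    proof -
      have "{s..k} = insert k {s..<k}" using that by auto
      thus ?thesis by simp
    qed
    moreover have "(\<Sum>s\<le>k. if s \<in> {k} then x s else y s) = x k + (\<Sum>s<k. y s)"
      by (simp flip: lessThan_Suc_atMost)
    ultimately show ?thesis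
      unfolding F_def by (simp del: power_Suc)
  qed
  have "fps_sum F ({..k} \<rightarrow>\<^sub>E UNIV) = fps_sum (\<lambda>x. chain k (x k)) ({k} \<rightarrow>\<^sub>E UNIV)"
    unfolding Un by (subst fps_sum_PiE_Un[OF _ s]) (simp_all only: F fps_sum_chain_PiE_lessThan, auto)
  also have "\<dots> = fps_sum (chain k) UNIV"
    by (subst fps_sum_PiE_singleton) simp_all
  finally show ?thesis
    unfolding F_def .
qed

section \<open>Evaluation of the series of the graphs Gamma\<close>

lemma prod_qpoch_telescope:
  "qpoch (u 0) * (\<Prod>s<m. qpoch (u (Suc s)) * inverse (qpoch (u s))) = qpoch (u m)"
proof (induction m)
  case (Suc m)
  have "qpoch (u 0) * (\<Prod>s<Suc m. qpoch (u (Suc s)) * inverse (qpoch (u s))) =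
        (qpoch (u 0) * (\<Prod>s<m. qpoch (u (Suc s)) * inverse (qpoch (u s)))) *
        (qpoch (u (Suc m)) * inverse (qpoch (u m)))"
    by (simp only: prod.lessThan_Suc mult.assoc)
  also have "\<dots> = qpoch (u (Suc m)) * (qpoch (u m) * inverse (qpoch (u m)))"
    unfolding Suc.IH by (simp only: mult_ac)
  finally show ?case by simp
qed simp

text \<open>Each (q)_(u_s + 1) is (q)_(u_s) (1 - q^(u_s + 1)). The quotients (q)_(u_(s+1))/(q)_(u_s)
  telescope from (q)_(u_0) to (q)_(u_k), and u_k = c_k supplies the one factor missing for the
  cancellation of all (q)_(c_t).\<close>

lemma prod_qpoch_ratio_collapse:
  fixes c :: "nat \<Rightarrow> nat" and k :: nat
  defines "u s \<equiv> \<Sum>t=s..k. c t"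
  shows "(\<Prod>t\<le>k. inverse (qpoch (c t))) * qpoch (u 0) *
      (\<Prod>s<k. qpoch (c s) * qpoch (u (Suc s)) * inverse (qpoch (Suc (u s)))) =
    (\<Prod>s<k. inverse (1 - fps_X ^ Suc (u s)))"
proof -
  have "(\<Prod>s<k. qpoch (c s) * qpoch (u (Suc s)) * inverse (qpoch (Suc (u s)))) =
        (\<Prod>s<k. qpoch (c s)) * (\<Prod>s<k. qpoch (u (Suc s)) * inverse (qpoch (u s))) *
        (\<Prod>s<k. inverse (1 - fps_X ^ Suc (u s)))"
    unfolding inverse_qpoch_Suc' prod.distrib by (simp only: mult_ac)
  hence "(\<Prod>t\<le>k. inverse (qpoch (c t))) * qpoch (u 0) *
      (\<Prod>s<k. qpoch (c s) * qpoch (u (Suc s)) * inverse (qpoch (Suc (u s)))) =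
    (\<Prod>t\<le>k. inverse (qpoch (c t))) * (\<Prod>s<k. qpoch (c s)) *
      (qpoch (u 0) * (\<Prod>s<k. qpoch (u (Suc s)) * inverse (qpoch (u s)))) *
      (\<Prod>s<k. inverse (1 - fps_X ^ Suc (u s)))"
    by (simp only: mult_ac)
  also have "qpoch (u 0) * (\<Prod>s<k. qpoch (u (Suc s)) * inverse (qpoch (u s))) = qpoch (c k)"
    unfolding prod_qpoch_telescope by (simp add: u_def)
  also have "(\<Prod>t\<le>k. inverse (qpoch (c t))) * (\<Prod>s<k. qpoch (c s)) * qpoch (c k) =
             (\<Prod>t\<le>k. inverse (qpoch (c t))) * (\<Prod>t\<le>k. qpoch (c t))"
    by (simp only: lessThan_Suc_atMost[symmetric] prod.lessThan_Suc mult.assoc)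
  also have "\<dots> = (\<Prod>t\<le>k. qpoch (c t) * inverse (qpoch (c t)))"
    by (simp only: prod.distrib mult.commute)
  finally show ?thesis by simp
qed

text \<open>The pairs $(b_s, c_t)$, $(d_s, c_s)$ and $(d_s, b_{s+1})$.\<close>

lemma Gamma_graph_eq:
  assumes "k \<ge> 1"
  shows "Gamma_graph k = edge_graph {1..3 * k + 2}
    ((\<lambda>(s, t). (3 * s + 1, 3 * t + 2)) ` (SIGMA s:{..k}. {s..k})
      \<union> (\<lambda>s. (3 * s + 3, 3 * s + 2)) ` {..<k} \<union> (\<lambda>s. (3 * s + 3, 3 * s + 4)) ` {..<k})"
proof -
  define E where "E = {(1, 2), (2, 3), (3, 4), (4, 5), (5, 1)}
      \<union> {(i, i + 1) |i. 5 \<le> i \<and> i \<le> 3 * k + 1}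
      \<union> {(1, 3 * t + 2) |t. 2 \<le> t \<and> t \<le> k}
      \<union> {(4, 3 * t + 2) |t. 2 \<le> t \<and> t \<le> k}
      \<union> {(3 * s + 1, 3 * (l + 1) + 2) |s l. 2 \<le> s \<and> s \<le> l \<and> l \<le> k - 1}"
  define F where "F = (\<lambda>(s, t). (3 * s + 1, 3 * t + 2)) ` (SIGMA s:{..k}. {s..k})
      \<union> (\<lambda>s. (3 * s + 3, 3 * s + 2)) ` {..<k} \<union> (\<lambda>s. (3 * s + 3, 3 * s + 4)) ` {..<k}"
  have F1: "(3 * s + 1, 3 * t + 2) \<in> F" if "s \<le> t" "t \<le> k" for s t
    using that unfolding F_def by force
  have F2: "(3 * s + 3, 3 * s + 2) \<in> F" "(3 * s + 3, 3 * s + 4) \<in> F" if "s < k" for s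
    using that unfolding F_def by auto
  have E1: "(i, i + 1) \<in> E" if "1 \<le> i" "i \<le> 3 * k + 1" for i
  proof (cases "i \<ge> 5")
    case True
    thus ?thesis using that unfolding E_def by blast
  next
    case False
    hence "i = 1 \<or> i = 2 \<or> i = 3 \<or> i = 4" using that by auto
    thus ?thesis unfolding E_def by auto
  qed
  have "E \<subseteq> F \<union> F\<inverse>"
  proof
    fix p assume "p \<in> E"
    then consider "p = (5, 1)" | i where "p = (i, i + 1)" "1 \<le> i" "i \<le> 3 * k + 1"
      | t where "p = (1, 3 * t + 2)" "t \<le> k" | t where "p = (4, 3 * t + 2)" "2 \<le> t" "t \<le> k"
      | s l where "p = (3 * s + 1, 3 * (l + 1) + 2)" "s \<le> l" "l \<le> k - 1"
      unfolding E_def using assms by (elim UnE) force+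
    thus "p \<in> F \<union> F\<inverse>"
    proof cases
      case 1
      thus ?thesis using F1[of 0 1] assms by simp
    next
      case (2 i)
      \<comment> \<open>The residue of i modulo 3 decides the type of a path edge: d_s to b_(s+1)
        for 0, b_s to c_s for 1, c_s to d_s for 2.\<close>
      have "\<exists>s. i = 3 * s + 3 \<or> i = 3 * s + 1 \<or> i = 3 * s + 2"
        using 2(2) by presburger
      then consider s where "i = 3 * s + 3" | s where "i = 3 * s + 1" | s where "i = 3 * s + 2"
        by blast
      thus ?thesis
      proof cases
        case (1 s)
        hence "p = (3 * s + 3, 3 * s + 4)" "s < k" using 2 by simp_all
        thus ?thesis using F2(2)[of s] by simp
      next
        case (2 s)
        thus ?thesis using \<open>p = _\<close> \<open>i \<le> _\<close> F1[of s s] by simp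
      next
        case (3 s)
        hence "p = (3 * s + 2, 3 * s + 3)" "s < k" using 2 by simp_all
        thus ?thesis using F2(1)[of s] by simp
      qed
    next
      case (3 t)
      thus ?thesis using F1[of 0 t] by simp
    next
      case (4 t)
      thus ?thesis using F1[of 1 t] by simp
    next
      case (5 s l)
      thus ?thesis using F1[of s "l + 1"] assms by simp
    qed
  qed
  moreover have "F \<subseteq> E \<union> E\<inverse>"
  proof
    fix p assume "p \<in> F"
    then consider s t where "p = (3 * s + 1, 3 * t + 2)" "s \<le> t" "t \<le> k"
      | s where "p = (3 * s + 3, 3 * s + 2)" "s < k" | s where "p = (3 * s + 3, 3 * s + 4)" "s < k"
      unfolding F_def by (elim UnE) auto
    thus "p \<in> E \<union> E\<inverse>"
    proof cases
      case (1 s t)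
      \<comment> \<open>In this order: a path edge, the edge from 5 to 1 that closes the pentagon,
        the chords at 1, the chords at 4, and the last family with l = t - 1.\<close>
      consider "s = t" | "s = 0" "t = 1" | "s = 0" "t \<ge> 2" | "s = 1" "t \<ge> 2" | "s \<ge> 2" "t > s"
        using 1(2) by linarith
      thus ?thesis
      proof cases
        case 1
        thus ?thesis using \<open>p = _\<close> \<open>t \<le> k\<close> E1[of "3 * s + 1"] by simp
      next
        case 5
        then obtain l where "t = l + 1" "s \<le> l"
          by (metis Suc_eq_plus1 less_Suc_eq_le not0_implies_Suc not_less_zero)
        moreover from this have "l \<le> k - 1" using 1(3) by simp
        ultimately have "p \<in> {(3 * s + 1, 3 * (l + 1) + 2) |s l. 2 \<le> s \<and> s \<le> l \<and> l \<le> k - 1}"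
          using 5 1(1) by blast
        thus ?thesis unfolding E_def by blast
      qed (use 1 in \<open>auto simp: E_def\<close>)
    next
      case (2 s)
      thus ?thesis using E1[of "3 * s + 2"] by (simp add: eval_nat_numeral)
    next
      case (3 s)
      thus ?thesis using E1[of "3 * s + 3"] by (simp add: eval_nat_numeral)
    qed
  qed
  ultimately have "E \<union> E\<inverse> = F \<union> F\<inverse>"
    by auto
  thus ?thesis
    unfolding Gamma_graph_def edge_graph_def E_def[symmetric] F_def[symmetric] by simp
qed

lemma Gamma_graph_1: "Gamma_graph 1 = cycle_graph 5"
proof -
  have cycle: "{(i, i + 1) |i. (1 :: nat) \<le> i \<and> i < 5} = {(1, 2), (2, 3), (3, 4), (4, 5)}"
  proof (intro equalityI subsetI)
    fix p :: "nat \<times> nat" assume "p \<in> {(i, i + 1) |i. 1 \<le> i \<and> i < 5}"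
    then obtain i where i: "p = (i, i + 1)" "1 \<le> i" "i < 5" by blast
    hence "i = 1 \<or> i = 2 \<or> i = 3 \<or> i = 4" by auto
    with i(1) show "p \<in> {(1, 2), (2, 3), (3, 4), (4, 5)}" by auto
  qed auto
  have empty: "{(i, i + 1) |i. (5 :: nat) \<le> i \<and> i \<le> 3 * 1 + 1} = {}"
    "{(1, 3 * t + 2) |t. (2 :: nat) \<le> t \<and> t \<le> 1} = {}"
    "{(4, 3 * t + 2) |t. (2 :: nat) \<le> t \<and> t \<le> 1} = {}"
    "{(3 * s + 1, 3 * (l + 1) + 2) |s l. (2 :: nat) \<le> s \<and> s \<le> l \<and> l \<le> 1 - 1} = {}"
    by auto
  show ?thesis
    unfolding Gamma_graph_def cycle_graph_def cycle empty by (simp add: insert_commute)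
qed

lemma T_graph_2: "T_graph 2 = edge_graph {1..6} {(1, 2), (1, 4), (2, 3), (4, 5), (1, 6)}"
proof -
  have "{f j |j. 1 \<le> j \<and> j \<le> 2} = {f 1, f 2}" for f :: "nat \<Rightarrow> nat \<times> nat"
  proof (intro equalityI subsetI)
    fix p assume "p \<in> {f j |j. 1 \<le> j \<and> j \<le> 2}"
    then obtain j where j: "p = f j" "1 \<le> j" "j \<le> 2" by blast
    hence "j = 1 \<or> j = 2" by auto
    with j(1) show "p \<in> {f 1, f 2}" by auto
  qed auto
  from this[of "\<lambda>j. (1, 2 * j)"] this[of "\<lambda>j. (2 * j, 2 * j + 1)"]
  show ?thesis
    unfolding T_graph_def by (simp add: insert_commute)
qed

text \<open>Vertex 1 carries b_0. It has no neighbour among the d_s and joins them in the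
  independent set, while B consists of the vertices 3s+4 of b_(s+1). Summing out d_s couples b_(s+1)
  to c_s by the factor (q)_(c_s + b_(s+1)), and summing out b_0 leaves (q)_(S_0). For fixed c the
  remaining b are independent of each other and fall to \<open>fps_sum_qpoch_ratio\<close>.\<close>

lemma graph_series_Gamma_graph:
  assumes "k \<ge> 1"
  shows "graph_series (Gamma_graph k) = euler_series ^ (k + 1) * fps_sum (chain k) UNIV"
proof -
  define C where "C = (\<lambda>t. 3 * t + 2) ` {..k}"
  define B where "B = (\<lambda>s. 3 * s + 4) ` {..<k}"
  define D where "D = (\<lambda>s. 3 * s + 3) ` {..<k}"
  define V where "V = C \<union> B \<union> insert 1 D"
  define E1 where "E1 = (\<lambda>(s, t). (3 * s + 1, 3 * t + 2)) ` (SIGMA s:{..k}. {s..k})"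
  define E2 where "E2 = (\<lambda>s. (3 * s + 3, 3 * s + 2)) ` {..<k}"
  define E3 where "E3 = (\<lambda>s. (3 * s + 3, 3 * s + 4)) ` {..<k}"
  define S where "S c s = (\<Sum>t=s..k. c t)" for c :: "nat \<Rightarrow> nat" and s
  define a where "a n = (\<Sum>t\<le>k. n (3 * t + 2)) + (\<Sum>s<k. n (3 * s + 4) * (S (\<lambda>t. n (3 * t + 2)) (Suc s) + 1))"
    for n :: "nat \<Rightarrow> nat"
  define b where "b n i = (if i = 1 then (\<Sum>t\<le>k. n (3 * t + 2)) else n (i - 1) + n (i + 1))"
    for n :: "nat \<Rightarrow> nat" and i
  have fin: "finite C" "finite B" "finite D" "finite E1" "finite E2" "finite E3"
    by (simp_all add: C_def B_def D_def E1_def E2_def E3_def)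
  have C: "i mod 3 = 2" if "i \<in> C" for i
  proof -
    from that obtain t where "i = 3 * t + 2" by (auto simp: C_def)
    thus ?thesis by presburger
  qed
  have B: "i mod 3 = 1 \<and> i > 1" if "i \<in> B" for i
  proof -
    from that obtain s where "i = 3 * s + 4" by (auto simp: B_def)
    thus ?thesis by presburger
  qed
  have D: "i mod 3 = 0" if "i \<in> D" for i
    using that by (auto simp: D_def)
  have disj: "C \<inter> B = {}" "1 \<notin> D" "(C \<union> B) \<inter> insert 1 D = {}"
    using C B D[of 1] D by force+
  have inj: "inj_on (\<lambda>t. 3 * t + 2) A" "inj_on (\<lambda>s. 3 * s + 4) A" "inj_on (\<lambda>s. 3 * s + 3) A" for A :: "nat set"
    by (auto simp: inj_on_def)
  have V: "{1..3 * k + 2} = V"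
  proof (intro equalityI subsetI)
    fix i assume i: "i \<in> {1..3 * k + 2}"
    have "\<exists>s. i = 3 * s + 2 \<or> i = 3 * s + 3 \<or> i = 1 \<or> i = 3 * s + 4"
      using i by simp presburger
    then consider s where "i = 3 * s + 2" | s where "i = 3 * s + 3" | "i = 1" | s where "i = 3 * s + 4"
      by blast
    thus "i \<in> V"
      by cases (use i in \<open>auto simp: V_def C_def B_def D_def\<close>)
  qed (auto simp: V_def C_def B_def D_def)
  have G: "Gamma_graph k = edge_graph V (E1 \<union> E2 \<union> E3)"
    unfolding Gamma_graph_eq[OF assms] V E1_def E2_def E3_def ..
  have E1: "fst p mod 3 = 1 \<and> snd p mod 3 = 2" if "p \<in> E1" for p
  proof -
    from that obtain s t where "p = (3 * s + 1, 3 * t + 2)" by (auto simp: E1_def)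
    thus ?thesis by simp presburger
  qed
  have E2: "fst p mod 3 = 0 \<and> snd p mod 3 = 2" if "p \<in> E2" for p
  proof -
    from that obtain s where "p = (3 * s + 3, 3 * s + 2)" by (auto simp: E2_def)
    thus ?thesis by simp presburger
  qed
  have E3: "fst p mod 3 = 0 \<and> snd p mod 3 = 1" if "p \<in> E3" for p
  proof -
    from that obtain s where "p = (3 * s + 3, 3 * s + 4)" by (auto simp: E3_def)
    thus ?thesis by simp
  qed
  \<comment> \<open>None of these three residue patterns is the reverse of itself or of another, so
    no edge is listed in both directions.\<close>
  have E: "(fst p mod 3, snd p mod 3) \<in> {(1, 2), (0, 2), (0, 1)}" if "p \<in> E1 \<union> E2 \<union> E3" for p
    using that E1[of p] E2[of p] E3[of p] by auto
  have anti: "(E1 \<union> E2 \<union> E3) \<inter> (E1 \<union> E2 \<union> E3)\<inverse> = {}"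
  proof (rule equals0I)
    fix p assume "p \<in> (E1 \<union> E2 \<union> E3) \<inter> (E1 \<union> E2 \<union> E3)\<inverse>"
    hence "p \<in> E1 \<union> E2 \<union> E3" "prod.swap p \<in> E1 \<union> E2 \<union> E3"
      by (cases p; simp)+
    from E[OF this(1)] E[OF this(2)] show False by auto
  qed
  have EV: "E1 \<union> E2 \<union> E3 \<subseteq> V \<times> V"
    unfolding V[symmetric] E1_def E2_def E3_def by auto
  have exponent: "graph_exponent (Gamma_graph k) n = a n + (\<Sum>j\<in>insert 1 D. n j * (b n j + 1))" for n
  proof -
    have E12: "E1 \<inter> E2 = {}" "(E1 \<union> E2) \<inter> E3 = {}"
      using E1 E2 E3 by force+
    have "(\<Sum>(i, j)\<in>E1. n i * n j) = (\<Sum>s\<le>k. n (3 * s + 1) * S (\<lambda>t. n (3 * t + 2)) s)"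
      unfolding E1_def S_def
      by (subst sum.reindex) (auto simp: inj_on_def sum.Sigma case_prod_unfold sum_distrib_left)
    \<comment> \<open>The term s = 0 belongs to vertex 1, which is summed out; the others are
      shifted, so that index s stands for b_(s+1).\<close>
    also have "\<dots> = n 1 * S (\<lambda>t. n (3 * t + 2)) 0 + (\<Sum>s<k. n (3 * s + 4) * S (\<lambda>t. n (3 * t + 2)) (Suc s))"
      by (subst sum.atMost_shift) (simp add: eval_nat_numeral)
    finally have sum1: "(\<Sum>(i, j)\<in>E1. n i * n j) =
        n 1 * S (\<lambda>t. n (3 * t + 2)) 0 + (\<Sum>s<k. n (3 * s + 4) * S (\<lambda>t. n (3 * t + 2)) (Suc s))" .
    have sum2: "(\<Sum>(i, j)\<in>E2. n i * n j) = (\<Sum>s<k. n (3 * s + 3) * n (3 * s + 2))"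
      unfolding E2_def by (subst sum.reindex) (auto simp: inj_on_def)
    have sum3: "(\<Sum>(i, j)\<in>E3. n i * n j) = (\<Sum>s<k. n (3 * s + 3) * n (3 * s + 4))"
      unfolding E3_def by (subst sum.reindex) (auto simp: inj_on_def)
    have sumE: "(\<Sum>(i, j)\<in>E1 \<union> E2 \<union> E3. n i * n j) =
        (\<Sum>(i, j)\<in>E1. n i * n j) + (\<Sum>(i, j)\<in>E2. n i * n j) + (\<Sum>(i, j)\<in>E3. n i * n j)"
      using fin E12 by (simp add: sum.union_disjoint)
    have sumD: "(\<Sum>i\<in>D. f i) = (\<Sum>s<k. f (3 * s + 3))" for f :: "nat \<Rightarrow> nat"
      unfolding D_def by (subst sum.reindex[OF inj(3)]) simp
    have sumC: "(\<Sum>i\<in>C. f i) = (\<Sum>t\<le>k. f (3 * t + 2))" for f :: "nat \<Rightarrow> nat"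
      unfolding C_def by (subst sum.reindex[OF inj(1)]) simp
    have sumB: "(\<Sum>i\<in>B. f i) = (\<Sum>s<k. f (3 * s + 4))" for f :: "nat \<Rightarrow> nat"
      unfolding B_def by (subst sum.reindex[OF inj(2)]) simp
    have sumV: "(\<Sum>i\<in>V. n i) = (\<Sum>t\<le>k. n (3 * t + 2)) + (\<Sum>s<k. n (3 * s + 4)) + (n 1 + (\<Sum>s<k. n (3 * s + 3)))"
    proof -
      have "(\<Sum>i\<in>V. n i) = (\<Sum>i\<in>C \<union> B. n i) + (\<Sum>i\<in>insert 1 D. n i)"
        unfolding V_def by (rule sum.union_disjoint) (use fin disj in simp_all)
      also have "(\<Sum>i\<in>C \<union> B. n i) = (\<Sum>i\<in>C. n i) + (\<Sum>i\<in>B. n i)"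
        by (rule sum.union_disjoint) (use fin disj in simp_all)
      also have "(\<Sum>i\<in>insert 1 D. n i) = n 1 + (\<Sum>i\<in>D. n i)"
        by (rule sum.insert) (use fin disj in simp_all)
      finally show ?thesis
        unfolding sumC sumB sumD .
    qed
    have S0: "S (\<lambda>t. n (3 * t + 2)) 0 = (\<Sum>t\<le>k. n (3 * t + 2))"
      by (simp add: S_def atLeast0AtMost)
    have "(\<Sum>j\<in>insert 1 D. n j * (b n j + 1)) = n 1 * (b n 1 + 1) + (\<Sum>j\<in>D. n j * (b n j + 1))"
      by (rule sum.insert) (use fin disj in simp_all)
    also have "(\<Sum>j\<in>D. n j * (b n j + 1)) = (\<Sum>s<k. n (3 * s + 3) * (n (3 * s + 2) + n (3 * s + 4) + 1))"
      unfolding sumD by (simp add: b_def eval_nat_numeral)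
    finally have "(\<Sum>j\<in>insert 1 D. n j * (b n j + 1)) = n 1 * ((\<Sum>t\<le>k. n (3 * t + 2)) + 1)
        + (\<Sum>s<k. n (3 * s + 3) * (n (3 * s + 2) + n (3 * s + 4) + 1))"
      by (simp add: b_def)
    moreover have "graph_exponent (Gamma_graph k) n = (\<Sum>(i, j)\<in>E1 \<union> E2 \<union> E3. n i * n j) + (\<Sum>i\<in>V. n i)"
      unfolding G using fin EV anti by (intro graph_exponent_edge_graph) (simp_all add: V_def)
    ultimately show ?thesis
      unfolding sumE sum1 sum2 sum3 sumV S0 a_def by (simp add: algebra_simps sum.distrib)
  qed
  have "graph_series (Gamma_graph k) = fps_sum (\<lambda>n. fps_X ^ graph_exponent (Gamma_graph k) n *
          (\<Prod>i\<in>V. inverse (qpoch (n i)))) (V \<rightarrow>\<^sub>E UNIV)"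
    using fin by (subst graph_series_eq) (simp_all add: graph_term_eq[abs_def] G edge_graph_def V_def)
  also have "\<dots> = euler_series ^ card (insert 1 D) *
      fps_sum (\<lambda>x. fps_X ^ a x * (\<Prod>i\<in>C \<union> B. inverse (qpoch (x i))) *
        (\<Prod>j\<in>insert 1 D. qpoch (b x j))) (C \<union> B \<rightarrow>\<^sub>E UNIV)"
    unfolding V_def
  proof (rule fps_sum_independent)
    show "(\<Sum>i\<in>C \<union> B \<union> insert 1 D. n i) \<le> graph_exponent (Gamma_graph k) n" for n
    proof -
      have "pverts (Gamma_graph k) = C \<union> B \<union> insert 1 D"
        by (simp add: G edge_graph_def V_def)
      thus ?thesis
        unfolding graph_exponent_def by (simp only: le_add2)
    qed
    show "graph_exponent (Gamma_graph k) n = a n + (\<Sum>j\<in>insert 1 D. n j * (b n j + 1))" for n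
      by (rule exponent)
    show "a n = a n'" if "\<And>i. i \<in> C \<union> B \<Longrightarrow> n i = n' i" for n n'
    proof -
      have "n (3 * t + 2) = n' (3 * t + 2)" if "t \<le> k" for t
        by (rule \<open>\<And>i. i \<in> C \<union> B \<Longrightarrow> n i = n' i\<close>) (use that in \<open>auto simp: C_def\<close>)
      moreover have "n (3 * s + 4) = n' (3 * s + 4)" if "s < k" for s
        by (rule \<open>\<And>i. i \<in> C \<union> B \<Longrightarrow> n i = n' i\<close>) (use that in \<open>auto simp: B_def\<close>)
      ultimately show ?thesis
        unfolding a_def S_def by (intro arg_cong2[of _ _ _ _ "(+)"] arg_cong2[of _ _ _ _ "(*)"] sum.cong refl) auto
    qed
    show "b n j = b n' j" if "\<And>i. i \<in> C \<union> B \<Longrightarrow> n i = n' i" "j \<in> insert 1 D" for n n' j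
    proof (cases "j = 1")
      case True
      have "n (3 * t + 2) = n' (3 * t + 2)" if "t \<le> k" for t
        by (rule \<open>\<And>i. i \<in> C \<union> B \<Longrightarrow> n i = n' i\<close>) (use that in \<open>auto simp: C_def\<close>)
      thus ?thesis using True by (simp add: b_def)
    next
      case False
      then obtain s where s: "j = 3 * s + 3" "s < k"
        using \<open>j \<in> insert 1 D\<close> by (auto simp: D_def)
      have "j - 1 = 3 * s + 2" "j + 1 = 3 * s + 4" using s by simp_all
      hence "j - 1 \<in> C \<union> B" "j + 1 \<in> C \<union> B"
        using s by (auto simp: C_def B_def)
      thus ?thesis using False that(1)[of "j - 1"] that(1)[of "j + 1"] by (simp add: b_def)
    qed
  qed (use fin disj in simp_all)
  also have "card (insert 1 D) = k + 1"
  proof -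
    have "card D = k"
      unfolding D_def by (subst card_image[OF inj(3)]) simp
    thus ?thesis using fin disj by simp
  qed
  also have "fps_sum (\<lambda>x. fps_X ^ a x * (\<Prod>i\<in>C \<union> B. inverse (qpoch (x i))) *
        (\<Prod>j\<in>insert 1 D. qpoch (b x j))) (C \<union> B \<rightarrow>\<^sub>E UNIV) = fps_sum (chain k) UNIV"
  proof -
    define f where "f x = fps_X ^ a x * (\<Prod>i\<in>C \<union> B. inverse (qpoch (x i))) *
        (\<Prod>j\<in>insert 1 D. qpoch (b x j))" for x
    define g where "g c = fps_X ^ (\<Sum>t\<le>k. c t) * (\<Prod>t\<le>k. inverse (qpoch (c t))) * qpoch (S c 0)" for c
    define h where "h c s m = fps_X ^ (m * (S c (Suc s) + 1)) * (qpoch (c s + m) * inverse (qpoch m))"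
      for c and s m :: nat
    \<comment> \<open>The argument d of \<open>H c d\<close> stands for the values at the vertices
      3s+4, that is for b_(s+1); the values at 3s+3 are already summed out.\<close>
    define H where "H c d = g c * (\<Prod>s<k. h c s (d s))" for c d
    \<comment> \<open>\<open>H\<close> reads c only up to k and d only below k. This permits the
      passage from assignments on C and B to assignments on \<open>{..k}\<close> and
      \<open>{..<k}\<close>.\<close>
    have H_cong: "H c d = H c' d'" if "\<And>t. t \<le> k \<Longrightarrow> c t = c' t" "\<And>s. s < k \<Longrightarrow> d s = d' s" for c c' d d'
    proof -
      have S: "S c s = S c' s" for s
        unfolding S_def using that(1) by (intro sum.cong) auto
      have "(\<Sum>t\<le>k. c t) = (\<Sum>t\<le>k. c' t)"
        using that(1) by (intro sum.cong) auto
      moreover have "(\<Prod>t\<le>k. inverse (qpoch (c t))) = (\<Prod>t\<le>k. inverse (qpoch (c' t)))"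
        using that(1) by (intro prod.cong) auto
      ultimately have "g c = g c'"
        unfolding g_def S by simp
      moreover have "h c s (d s) = h c' s (d' s)" if "s < k" for s
        unfolding h_def S using that \<open>\<And>t. t \<le> k \<Longrightarrow> c t = c' t\<close>[of s] \<open>\<And>s. s < k \<Longrightarrow> d s = d' s\<close>[of s]
        by simp
      ultimately show ?thesis
        unfolding H_def by (intro arg_cong2[of _ _ _ _ "(*)"] prod.cong refl) auto
    qed
    have f: "f x = H (\<lambda>t. x (3 * t + 2)) (\<lambda>s. x (3 * s + 4))" for x
    proof -
      have "(\<Prod>i\<in>C \<union> B. inverse (qpoch (x i))) = (\<Prod>i\<in>C. inverse (qpoch (x i))) * (\<Prod>i\<in>B. inverse (qpoch (x i)))"
        by (rule prod.union_disjoint) (use fin disj in simp_all)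
      also have "(\<Prod>i\<in>C. inverse (qpoch (x i))) = (\<Prod>t\<le>k. inverse (qpoch (x (3 * t + 2))))"
        unfolding C_def by (subst prod.reindex[OF inj(1)]) simp
      also have "(\<Prod>i\<in>B. inverse (qpoch (x i))) = (\<Prod>s<k. inverse (qpoch (x (3 * s + 4))))"
        unfolding B_def by (subst prod.reindex[OF inj(2)]) simp
      finally have 1: "(\<Prod>i\<in>C \<union> B. inverse (qpoch (x i))) =
          (\<Prod>t\<le>k. inverse (qpoch (x (3 * t + 2)))) * (\<Prod>s<k. inverse (qpoch (x (3 * s + 4))))" .
      have "(\<Prod>j\<in>insert 1 D. qpoch (b x j)) = qpoch (b x 1) * (\<Prod>j\<in>D. qpoch (b x j))"
        by (rule prod.insert) (use fin disj in simp_all)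
      also have "(\<Prod>j\<in>D. qpoch (b x j)) = (\<Prod>s<k. qpoch (x (3 * s + 2) + x (3 * s + 4)))"
        unfolding D_def by (subst prod.reindex[OF inj(3)]) (simp add: b_def eval_nat_numeral)
      also have "b x 1 = S (\<lambda>t. x (3 * t + 2)) 0"
        by (simp add: b_def S_def atLeast0AtMost)
      finally have 2: "(\<Prod>j\<in>insert 1 D. qpoch (b x j)) = qpoch (S (\<lambda>t. x (3 * t + 2)) 0) *
          (\<Prod>s<k. qpoch (x (3 * s + 2) + x (3 * s + 4)))" .
      show ?thesis
        unfolding f_def 1 2 a_def H_def g_def h_def prod.distrib power_add power_sum
        by (simp only: mult_ac)
    qed
    have "(\<Sum>i\<in>C \<union> B. x i) \<le> a x" for x :: "nat \<Rightarrow> nat"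
    proof -
      have "(\<Sum>i\<in>C \<union> B. x i) = (\<Sum>i\<in>C. x i) + (\<Sum>i\<in>B. x i)"
        by (rule sum.union_disjoint) (use fin disj in simp_all)
      also have "(\<Sum>i\<in>C. x i) = (\<Sum>t\<le>k. x (3 * t + 2))"
        unfolding C_def by (subst sum.reindex[OF inj(1)]) simp
      also have "(\<Sum>i\<in>B. x i) = (\<Sum>s<k. x (3 * s + 4))"
        unfolding B_def by (subst sum.reindex[OF inj(2)]) simp
      finally show ?thesis
        unfolding a_def by (simp add: sum_mono)
    qed
    hence "fps_summable (\<lambda>x. fps_X ^ a x * ((\<Prod>i\<in>C \<union> B. inverse (qpoch (x i))) *
        (\<Prod>j\<in>insert 1 D. qpoch (b x j)))) (C \<union> B \<rightarrow>\<^sub>E UNIV)"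
      using fin by (intro fps_summable_PiE_X_power) simp_all
    hence s: "fps_summable f (C \<union> B \<rightarrow>\<^sub>E UNIV)"
      unfolding f_def by (simp only: mult.assoc)
    have merge: "f (\<lambda>i. if i \<in> C then x i else y i) = H (\<lambda>t. x (3 * t + 2)) (\<lambda>s. y (3 * s + 4))" for x y
      unfolding f
    proof (rule H_cong)
      show "(if 3 * t + 2 \<in> C then x (3 * t + 2) else y (3 * t + 2)) = x (3 * t + 2)" if "t \<le> k" for t
        using that by (simp add: C_def)
      show "(if 3 * s + 4 \<in> C then x (3 * s + 4) else y (3 * s + 4)) = y (3 * s + 4)" if "s < k" for s
      proof -
        have "3 * s + 4 \<in> B" using that by (simp add: B_def)
        thus ?thesis using disj(1) by auto
      qed
    qed
    have sh: "fps_summable (h c s) UNIV" for c s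
      unfolding h_def by (rule fps_summable_nat_X_power) simp
    have H: "fps_sum (H c) ({..<k} \<rightarrow>\<^sub>E UNIV) =
        fps_X ^ (\<Sum>t\<le>k. c t) * (\<Prod>s<k. inverse (1 - fps_X ^ Suc (S c s)))" for c
    proof -
      have "fps_sum (H c) ({..<k} \<rightarrow>\<^sub>E UNIV) = g c * (\<Prod>s<k. fps_sum (h c s) UNIV)"
        unfolding H_def fps_sum_mult_left[OF fps_summable_prod_PiE[OF finite_lessThan sh]]
          fps_sum_prod_PiE[OF finite_lessThan sh] ..
      also have "(\<Prod>s<k. fps_sum (h c s) UNIV) =
          (\<Prod>s<k. qpoch (c s) * qpoch (S c (Suc s)) * inverse (qpoch (Suc (S c s))))"
      proof (rule prod.cong)
        fix s assume "s \<in> {..<k}"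
        \<comment> \<open>This identifies the denominator (q)_(c_s + S_(s+1) + 1) of
          \<open>fps_sum_qpoch_ratio\<close> with (q)_(S_s + 1).\<close>
        hence "S c s = c s + S c (Suc s)"
          unfolding S_def by (simp add: sum.atLeast_Suc_atMost)
        thus "fps_sum (h c s) UNIV = qpoch (c s) * qpoch (S c (Suc s)) * inverse (qpoch (Suc (S c s)))"
          unfolding h_def by (simp only: fps_sum_qpoch_ratio)
      qed simp
      also have "g c * \<dots> = fps_X ^ (\<Sum>t\<le>k. c t) * (\<Prod>s<k. inverse (1 - fps_X ^ Suc (S c s)))"
        using prod_qpoch_ratio_collapse[of c k] unfolding g_def S_def by (simp only: mult.assoc)
      finally show ?thesis .
    qed
    have "fps_sum f (C \<union> B \<rightarrow>\<^sub>E UNIV) =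
        fps_sum (\<lambda>x. fps_sum (\<lambda>y. H (\<lambda>t. x (3 * t + 2)) (\<lambda>s. y (3 * s + 4))) (B \<rightarrow>\<^sub>E UNIV)) (C \<rightarrow>\<^sub>E UNIV)"
      unfolding fps_sum_PiE_Un[OF disj(1) s] merge ..
    also have "\<dots> = fps_sum (\<lambda>x. fps_sum (H (\<lambda>t. x (3 * t + 2))) ({..<k} \<rightarrow>\<^sub>E UNIV)) (C \<rightarrow>\<^sub>E UNIV)"
      unfolding B_def
      by (intro fps_sum_cong fps_sum_PiE_image inj(2) H_cong) simp_all
    also have "\<dots> = fps_sum (\<lambda>c. fps_sum (H c) ({..<k} \<rightarrow>\<^sub>E UNIV)) ({..k} \<rightarrow>\<^sub>E UNIV)"
      unfolding C_def
    proof (rule fps_sum_PiE_image[OF inj(1)])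
      fix c c' :: "nat \<Rightarrow> nat"
      assume "\<And>t. t \<in> {..k} \<Longrightarrow> c t = c' t"
      thus "fps_sum (H c) ({..<k} \<rightarrow>\<^sub>E UNIV) = fps_sum (H c') ({..<k} \<rightarrow>\<^sub>E UNIV)"
        by (intro fps_sum_cong H_cong) simp_all
    qed
    also have "\<dots> = fps_sum (chain k) UNIV"
      unfolding H S_def by (rule fps_sum_chain_PiE_atMost)
    finally show ?thesis
      unfolding f_def .
  qed
  finally show ?thesis .
qed

theorem corollary1p2:
  shows "(\<forall>k::nat. k \<ge> 1 \<longrightarrow>
            graph_series (Gamma_graph k \<oplus> pt) =
              of_nat k * graph_series (T_graph (k + 1))
              - (of_nat k - 1) * graph_series (T_graph k \<oplus> pt))
         \<and> Gamma_graph 1 = cycle_graph 5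
         \<and> digraph_iso (with_proj (T_graph 2)) (with_proj E6_graph)
         \<and> graph_series (cycle_graph 5 \<oplus> pt) = graph_series E6_graph"
proof -
  have main: "graph_series (Gamma_graph k \<oplus> pt) =
      of_nat k * graph_series (T_graph (k + 1)) - (of_nat k - 1) * graph_series (T_graph k \<oplus> pt)"
    if "k \<ge> 1" for k
  proof -
    \<comment> \<open>The isolated vertex contributes one Euler factor, which brings all three
      series to the common factor \<open>euler_series ^ (k + 2)\<close>; the larger tree has it
      already.\<close>
    have "graph_series (Gamma_graph k \<oplus> pt) = euler_series ^ (k + 2) * fps_sum (chain k) UNIV"
      using that by (simp add: graph_series_disjoint_union pair_graph_Gamma pair_graph_pt
          graph_series_Gamma_graph graph_series_pt mult_ac)
    moreover have "graph_series (T_graph k \<oplus> pt) = euler_series ^ (k + 2) * star_series k"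
      by (simp add: graph_series_disjoint_union pair_graph_T pair_graph_pt
          graph_series_T_graph graph_series_pt mult_ac)
    moreover have "graph_series (T_graph (k + 1)) = euler_series ^ (k + 2) * star_series (Suc k)"
      by (simp add: graph_series_T_graph)
    ultimately show ?thesis
      by (simp only: fps_sum_chain_star_series algebra_simps)
  qed
  \<comment> \<open>The relabelling sends the centre 1 to the branch node 4, the leaf 6 to 2, the
    leg 2, 3 to 3, 1 and the leg 4, 5 to 5, 6.\<close>
  define f :: "nat \<Rightarrow> nat" where "f i = [4, 3, 1, 5, 6, 2] ! (i - 1)" for i
  have six: "{1..6} = {1, 2, 3, 4, 5, 6 :: nat}"
    by auto
  have f: "f 1 = 4" "f 2 = 3" "f 3 = 1" "f 4 = 5" "f 5 = 6" "f 6 = 2"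
    by (simp_all add: f_def)
  have V: "pverts (T_graph 2) = {1, 2, 3, 4, 5, 6}" "pverts E6_graph = {1, 2, 3, 4, 5, 6}"
    by (simp_all only: T_graph_2 E6_graph_def edge_graph_def six pair_pre_digraph.simps)
  have inj: "inj_on f (pverts (T_graph 2))"
    by (simp add: V inj_on_def f f[simplified])
  have verts: "pverts E6_graph = f ` pverts (T_graph 2)"
    unfolding V by (simp add: f f[simplified] insert_commute)
  have conv: "(insert (i, j) A)\<inverse> = insert (j, i) (A\<inverse>)" for i j :: nat and A
    by auto
  have arcs: "parcs E6_graph = map_prod f f ` parcs (T_graph 2)"
    by (simp add: T_graph_2 E6_graph_def edge_graph_def conv f f[simplified] insert_commute)
  interpret T: pair_graph "T_graph 2"
    by (rule pair_graph_T)
  have E6: "graph_series E6_graph = graph_series (T_graph 2)"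
  proof (rule graph_series_iso[OF _ _ inj verts arcs])
    show "parcs (T_graph 2) \<subseteq> pverts (T_graph 2) \<times> pverts (T_graph 2)"
      by (auto simp: T_graph_2 edge_graph_def)
  qed simp
  \<comment> \<open>At k = 1 the coefficient k - 1 is 0, and only the series of
    \<open>T_graph 2\<close> remains.\<close>
  have "graph_series (cycle_graph 5 \<oplus> pt) = graph_series E6_graph"
    using main[of 1] by (simp add: E6 Gamma_graph_1[simplified] numeral_2_eq_2)
  moreover have "digraph_iso (with_proj (T_graph 2)) (with_proj E6_graph)"
    by (rule digraph_iso_with_projI[OF _ inj verts arcs]) unfold_locales
  ultimately show ?thesis
    using main Gamma_graph_1 by blast
qed

end
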